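(* There exists $M>0$ such that, for any integer $m\ge M$, there exist $C^\infty$ functions $\Phi_m$ and $G_m$ on the sphere $\mathbb{S}^2$ with the following properties. (1) The super-level set $\{\Phi_m>1\}$ has infinitely many connected components. (2) The function $G_m$ is positive, and defines a conformal metric $g_m=G_m\,g_0$ on $\mathbb{S}^2$ with associated Laplace-Beltrami operator $\Delta_{G_m}=G_m^{-1}\Delta_0$. (3) For $m\ge M$, $\left(1-\frac{2}{m}\right)\le G_m\le\left(1+\frac{2}{m}\right)$. (4) $-\Delta_{G_m}\Phi_m=m(m+1)\,\Phi_m$.
   Context: $g_0$ is the standard round metric on the unit sphere $\mathbb{S}^2\subset\mathbb{R}^3$ and $\Delta_0$ is its Laplace-Beltrami operator. *)

theory Defs
  imports "HOL-Analysis.Analysis"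
begin

definition partial_deriv :: "'n::finite \<Rightarrow> (real^'n \<Rightarrow> 'b::real_normed_vector) \<Rightarrow> real^'n \<Rightarrow> 'b" where
  "partial_deriv i f y = frechet_derivative f (at y) (axis i 1)"

primrec Ck :: "nat \<Rightarrow> (real^'n::finite \<Rightarrow> real) \<Rightarrow> bool" where
  "Ck 0 f \<longleftrightarrow> continuous_on UNIV f"
| "Ck (Suc k) f \<longleftrightarrow> f differentiable_on UNIV \<and> (\<forall>i. Ck k (partial_deriv i f))"

definition C_infinity :: "(real^'n::finite \<Rightarrow> real) \<Rightarrow> bool" where
  "C_infinity f \<longleftrightarrow> (\<forall>k. Ck k f)"

abbreviation S2 :: "(real^3) set" where
  "S2 \<equiv> sphere 0 1"

(* The smooth structure of the sphere is given by the two stereographic parametrizations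
   from the poles (0, 0, s), where s is 1 or -1. Objects on the sphere are encoded by total
   functions on real^3; only their values at points of S2 (and, for metrics, on tangent
   vectors at such points) are ever used. *)

definition stereo :: "real \<Rightarrow> real^2 \<Rightarrow> real^3" where
  "stereo s y = (1 / (1 + (norm y)\<^sup>2)) *\<^sub>R vector [2 * y$1, 2 * y$2, s * ((norm y)\<^sup>2 - 1)]"

definition stereo_chart :: "real \<Rightarrow> real^3 \<Rightarrow> real^2" where
  "stereo_chart s p = (1 / (1 - s * p$3)) *\<^sub>R vector [p$1, p$2]"

lemma norm2_sq: "(norm (y::real^2))\<^sup>2 = (y$1)\<^sup>2 + (y$2)\<^sup>2"
  unfolding power2_norm_eq_inner inner_vec_def sum_2 by (simp add: power2_eq_square)

lemma norm3_sq: "(norm (p::real^3))\<^sup>2 = (p$1)\<^sup>2 + (p$2)\<^sup>2 + (p$3)\<^sup>2"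
  unfolding power2_norm_eq_inner inner_vec_def sum_3 by (simp add: power2_eq_square)

lemma S2_iff: "p \<in> S2 \<longleftrightarrow> (p$1)\<^sup>2 + (p$2)\<^sup>2 + (p$3)\<^sup>2 = 1"
  using norm3_sq[of p] by (simp add: power2_eq_1_iff) (smt (verit) norm_ge_zero power2_eq_1_iff)

lemma stereo_in_S2:
  assumes "s \<in> {1, -1}"
  shows "stereo s y \<in> S2"
proof -
  define n where "n = (norm y)\<^sup>2"
  have n: "(y$1)\<^sup>2 + (y$2)\<^sup>2 = n" "n \<ge> 0"
    by (simp_all add: n_def norm2_sq)
  have s: "s\<^sup>2 = 1" using assms by auto
  have "(2 * y$1)\<^sup>2 + (2 * y$2)\<^sup>2 + (s * (n - 1))\<^sup>2 = 4 * n + (n - 1)\<^sup>2"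
    using n(1) s by (simp add: power_mult_distrib)
  also have "\<dots> = (1 + n)\<^sup>2" by (simp add: power2_eq_square algebra_simps)
  finally show ?thesis
    using n(2) unfolding S2_iff stereo_def n_def[symmetric]
    by (simp add: power_divide add_divide_distrib[symmetric])
qed

lemma stereo_stereo_chart:
  assumes "s \<in> {1, -1}" "p \<in> S2" "s * p$3 \<noteq> 1"
  shows "stereo s (stereo_chart s p) = p"
proof -
  define t where "t = s * p$3"
  have t: "1 - t \<noteq> 0" "s * t = p$3" using assms(1,3) by (auto simp: t_def)
  have "t\<^sup>2 = (p$3)\<^sup>2" using assms(1) by (auto simp: t_def)
  then have q: "(p$1)\<^sup>2 + (p$2)\<^sup>2 = (1 - t) * (1 + t)"
    using assms(2) unfolding S2_iff by (simp add: power2_eq_square algebra_simps)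
  have "(norm (stereo_chart s p))\<^sup>2 = ((p$1)\<^sup>2 + (p$2)\<^sup>2) / (1 - t)\<^sup>2"
    unfolding norm2_sq stereo_chart_def t_def[symmetric]
    by (simp add: power_divide add_divide_distrib)
  also have "\<dots> = (1 + t) / (1 - t)"
    unfolding q using t(1) by (simp add: power2_eq_square)
  finally have N: "(norm (stereo_chart s p))\<^sup>2 = (1 + t) / (1 - t)" .
  have a: "1 / (1 + (1 + t) / (1 - t)) = (1 - t) / 2"
    using t(1) by (simp add: field_simps)
  have b: "(1 + t) / (1 - t) - 1 = 2 * t / (1 - t)"
    using t(1) by (simp add: field_simps)
  show ?thesis
    unfolding stereo_def N a b unfolding stereo_chart_def t_def[symmetric]
    using t by (simp add: vec_eq_iff forall_3)
qed

definition smooth_on_S2 :: "(real^3 \<Rightarrow> real) \<Rightarrow> bool" where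
  "smooth_on_S2 f \<longleftrightarrow> (\<forall>s\<in>{1, -1}. C_infinity (\<lambda>y. f (stereo s y)))"

definition tangent_S2 :: "real^3 \<Rightarrow> (real^3) set" where
  "tangent_S2 p = {v. p \<bullet> v = 0}"

type_synonym metric = "real^3 \<Rightarrow> real^3 \<Rightarrow> real^3 \<Rightarrow> real"

definition gram :: "metric \<Rightarrow> real \<Rightarrow> real^2 \<Rightarrow> real^2^2" where
  "gram g s y = (\<chi> i j. g (stereo s y) (partial_deriv i (stereo s) y) (partial_deriv j (stereo s) y))"

definition riemannian_metric :: "metric \<Rightarrow> bool" where
  "riemannian_metric g \<longleftrightarrow>
     (\<forall>p\<in>S2.
        (\<forall>u\<in>tangent_S2 p. \<forall>v\<in>tangent_S2 p. g p u v = g p v u) \<and>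
        (\<forall>u\<in>tangent_S2 p. \<forall>v\<in>tangent_S2 p. \<forall>w\<in>tangent_S2 p. \<forall>a b.
           g p (a *\<^sub>R u + b *\<^sub>R v) w = a * g p u w + b * g p v w) \<and>
        (\<forall>u\<in>tangent_S2 p. u \<noteq> 0 \<longrightarrow> g p u u > 0)) \<and>
     (\<forall>s\<in>{1, -1}. \<forall>i j. C_infinity (\<lambda>y. gram g s y $ i $ j))"

definition round_metric :: metric where
  "round_metric p u v = u \<bullet> v"

lemma gram_round_metric:
  assumes "s \<in> {1, -1}"
  shows "gram round_metric s y = mat (4 / (1 + (norm y)\<^sup>2)\<^sup>2)"
proof -
  define E where "E v = (vector [2 * v$1, 2 * v$2, 0] :: real^3)" for v :: "real^2"
  have linE: "linear E"
    by (rule linearI) (simp_all add: E_def vec_eq_iff forall_3 algebra_simps)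
  then have E: "(E has_derivative E) (at y)"
    by (simp add: linear_imp_has_derivative)
  define e :: "real^3" where "e = axis 3 1"
  define D where "D v = (1 / (1 + y \<bullet> y)) *\<^sub>R (E v + (2 * s * (y \<bullet> v)) *\<^sub>R e)
      - (2 * (y \<bullet> v) / (1 + y \<bullet> y)\<^sup>2) *\<^sub>R (E y + (s * (y \<bullet> y - 1)) *\<^sub>R e)" for v
  have pos: "1 + y \<bullet> y \<noteq> 0"
    by (smt (verit) inner_ge_zero)
  have eq: "stereo s = (\<lambda>y. inverse (1 + y \<bullet> y) *\<^sub>R (E y + (s * (y \<bullet> y - 1)) *\<^sub>R e))"
    by (rule ext) (simp add: stereo_def E_def e_def axis_def vec_eq_iff forall_3
        power2_norm_eq_inner divide_inverse)
  have "(stereo s has_derivative D) (at y)"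
    unfolding eq D_def
    by (rule derivative_eq_intros E refl | simp add: pos)+
      (simp add: fun_eq_iff scaleR_add_right scaleR_diff_right inner_commute field_simps power2_eq_square)
  then have pd: "partial_deriv i (stereo s) y = D (axis i 1)" for i
    unfolding partial_deriv_def by (simp add: frechet_derivative_at[symmetric])
  define n where "n = y \<bullet> y"
  have n: "n = y$1 * y$1 + y$2 * y$2" "1 + n \<noteq> 0" "n \<ge> 0"
    using pos by (simp_all add: n_def inner_vec_def sum_2)
  define q where "q = inverse (1 + n)"
  have q: "q * (1 + n) = 1"
    using n(2) by (simp add: q_def)
  have s: "s * s = 1" using assms by auto
  have D': "D v = vector
      [2 * q * v$1 - 4 * q\<^sup>2 * (y \<bullet> v) * y$1, 2 * q * v$2 - 4 * q\<^sup>2 * (y \<bullet> v) * y$2, 4 * s * q\<^sup>2 * (y \<bullet> v)]" for v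
  proof -
    have "2 * s * (y \<bullet> v) * q - 2 * (y \<bullet> v) * q\<^sup>2 * (s * (n - 1)) = 4 * s * q\<^sup>2 * (y \<bullet> v)"
      using q by algebra
    then show ?thesis
      unfolding D_def n_def[symmetric]
      by (simp add: vec_eq_iff forall_3 E_def e_def axis_def q_def divide_inverse power_inverse mult_ac)
  qed
  have "D u \<bullet> D v = 4 * q\<^sup>2 * (u$1 * v$1 + u$2 * v$2)" for u v
  proof -
    have yv: "y \<bullet> w = y$1 * w$1 + y$2 * w$2" for w
      by (simp add: inner_vec_def sum_2)
    show ?thesis
      unfolding D' inner_vec_def[where 'b=3] sum_3 yv
      using q s unfolding n(1) by (simp) algebra
  qed
  then show ?thesis
    unfolding gram_def pd round_metric_def power2_norm_eq_inner n_def[symmetric]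
    by (simp add: vec_eq_iff forall_2 mat_def axis_def q_def divide_inverse power_inverse)
qed

definition conformal_metric :: "(real^3 \<Rightarrow> real) \<Rightarrow> metric \<Rightarrow> metric" where
  "conformal_metric G g p u v = G p * g p u v"

(* |g|^(-1/2) * sum_i d_i (|g|^(1/2) * sum_j g^(ij) d_j f) in the parametrization stereo s *)
definition laplace_beltrami_coord :: "metric \<Rightarrow> real \<Rightarrow> (real^3 \<Rightarrow> real) \<Rightarrow> real^2 \<Rightarrow> real" where
  "laplace_beltrami_coord g s f y =
     (1 / sqrt (det (gram g s y))) *
     (\<Sum>i\<in>UNIV. partial_deriv i
        (\<lambda>z. sqrt (det (gram g s z)) *
             (\<Sum>j\<in>UNIV. matrix_inv (gram g s z) $ i $ j * partial_deriv j (\<lambda>x. f (stereo s x)) z)) y)"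

(* For smooth f and g the coordinate expression does not depend on the chart, so it is
   evaluated in the chart stereo 1, except at its pole (0, 0, 1). *)
definition laplace_beltrami :: "metric \<Rightarrow> (real^3 \<Rightarrow> real) \<Rightarrow> real^3 \<Rightarrow> real" where
  "laplace_beltrami g f p =
     (let s = (if p$3 = 1 then -1 else 1) in laplace_beltrami_coord g s f (stereo_chart s p))"

end

theory Submission
  imports Defs
begin

text \<open>
  Let \<open>P = Re ((x + iy)\<^sup>m)\<close> be the sectoral harmonic of degree \<open>m\<close>. On the parallel at height \<open>z\<close> its
  maximum is \<open>(1 - z\<^sup>2) powr (m/2)\<close>, attained in particular at longitude 0. Multiply it by a function
  \<open>H = B powr (-m/2)\<close> of the height. The product exceeds 1 somewhere on the parallel exactly when
  \<open>B < 1 - z\<^sup>2\<close>. Writing \<open>B = 1 - z\<^sup>2 + \<eta>\<close>, the super-level set lies over the heights with \<open>\<eta> < 0\<close> and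
  meets each of these parallels (\<open>ripple_neg_if_rippled_harmonic_gt_1\<close>,
  \<open>rippled_harmonic_gt_1_if_ripple_neg\<close>). If \<open>\<eta>\<close> changes sign infinitely often, the height
  separates infinitely many pieces of the set from each other
  (\<open>infinite_components_if_separated\<close>).

  Since \<open>P\<close> is homogeneous and harmonic, \<open>laplace_beltrami_height_times_sectoral\<close> gives
  \<open>-\<Delta>\<^sub>0 (H P) = (m (m + 1) - T) H P\<close> with \<open>T = ((1 - z\<^sup>2) H'' - 2 (m + 1) z H') / H\<close>. There is no
  division by \<open>P\<close>, so the zeros of the eigenfunction cause no difficulty: the function
  \<open>G = 1 - T / (m (m + 1))\<close> is smooth, depends on the height only, and satisfies
  \<open>-\<Delta>\<^sub>0 \<Phi> = m (m + 1) G \<Phi>\<close> for \<open>\<Phi> = H P\<close>. In dimension two the Laplacian of \<open>G g\<^sub>0\<close> is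
  \<open>\<Delta>\<^sub>0 / G\<close> (\<open>laplace_beltrami_conformal\<close>), so it only remains to keep \<open>|T| \<le> 2 (m + 1)\<close>.

  The product must be nearly constant along the meridian near the equator, which means that
  \<open>\<eta>\<close> is flat there and \<open>B\<close> is close to \<open>1 - z\<^sup>2\<close>. This cancels the meridional second
  derivative \<open>-m\<close> of \<open>P\<close> and costs about \<open>T = m\<close>, half of the allowance. Elsewhere \<open>B\<close> should be
  constant, which gives \<open>T = 0\<close>. The transition is made at heights of order \<open>\<surd>\<epsilon>\<close> with
  \<open>\<epsilon> = 1/(100 m)\<close>: for \<open>\<eta> = z\<^sup>2 E (\<epsilon>/z\<^sup>2)\<close> the function \<open>1 - B\<close>, the square of its first derivative,
  and \<open>z\<close> times its first derivative are of order \<open>\<epsilon>\<close>, so their contributions to \<open>T\<close> are small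
  compared with \<open>m\<close>. What is left is essentially \<open>(m/2) (2 - \<eta>'')\<close>, and the explicit choice
  \<open>E (x) = exp (-2x) + exp (-x) sin x / 16\<close> keeps \<open>|2 - \<eta>''| \<le> 3\<close> (\<open>profile_bounds\<close>), which leads to the
  bound \<open>abs_defect_le\<close>. The first summand of \<open>E\<close> shapes the transition, and near the equator, as
  \<open>x \<rightarrow> \<infinity>\<close>, the second one dominates and makes the sign of \<open>\<eta>\<close> alternate.
\<close>

section \<open>Calculus of smooth functions\<close>

lemma partial_deriv_eq:
  "(f has_derivative f') (at y) \<Longrightarrow> partial_deriv i f y = f' (axis i 1)"
  unfolding partial_deriv_def by (simp add: frechet_derivative_at[symmetric])

text \<open>The predicate \<^const>\<open>Ck\<close> speaks about \<^const>\<open>frechet_derivative\<close>, a choice operator. This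
  rule accepts any explicit derivative instead, and its converse returns a
  \<^const>\<open>has_derivative\<close> fact, so that the closure properties below reduce to the
  differentiation rules and an induction on the order.\<close>

lemma Ck_SucI:
  assumes "\<And>y. (f has_derivative f' y) (at y)"
    and "\<And>i. Ck k (\<lambda>y. f' y (axis i 1))"
  shows "Ck (Suc k) f"
proof -
  have "partial_deriv i f = (\<lambda>y. f' y (axis i 1))" for i
    using assms(1) by (auto simp: partial_deriv_eq)
  moreover have "f differentiable_on UNIV"
    using assms(1) by (auto simp: differentiable_on_def differentiable_def)
  ultimately show ?thesis using assms(2) by simp
qed

lemma Ck_SucD:
  assumes "Ck (Suc k) f"
  shows "(f has_derivative frechet_derivative f (at y)) (at y)"
    and "Ck k (\<lambda>y. frechet_derivative f (at y) (axis i 1))"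
proof -
  show "(f has_derivative frechet_derivative f (at y)) (at y)"
    using assms by (simp add: differentiable_on_def frechet_derivative_works)
  have "Ck k (partial_deriv i f)" using assms by simp
  moreover have "partial_deriv i f = (\<lambda>y. frechet_derivative f (at y) (axis i 1))"
    by (auto simp: partial_deriv_def)
  ultimately show "Ck k (\<lambda>y. frechet_derivative f (at y) (axis i 1))" by simp
qed

lemma Ck_Suc_imp_Ck: "Ck (Suc k) f \<Longrightarrow> Ck k f"
proof (induction k arbitrary: f)
  case 0
  then show ?case by (simp add: differentiable_imp_continuous_on)
next
  case (Suc k)
  then show ?case by simp
qed

lemma Ck_const: "Ck k (\<lambda>y. c)"
proof (induction k arbitrary: c)
  case (Suc k)
  show ?case by (rule Ck_SucI[where f' = "\<lambda>_ _. 0"]) (use Suc in auto)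
qed simp

lemma Ck_add: "Ck k f \<Longrightarrow> Ck k g \<Longrightarrow> Ck k (\<lambda>y. f y + g y)"
proof (induction k arbitrary: f g)
  case 0
  then show ?case by (auto intro: continuous_intros)
next
  case (Suc k)
  show ?case
    by (rule Ck_SucI[OF has_derivative_add[OF Ck_SucD(1)[OF Suc.prems(1)] Ck_SucD(1)[OF Suc.prems(2)]]])
      (intro Suc.IH Ck_SucD(2) Suc.prems)
qed

lemma Ck_mult: "Ck k f \<Longrightarrow> Ck k g \<Longrightarrow> Ck k (\<lambda>y. f y * g y)"
proof (induction k arbitrary: f g)
  case 0
  then show ?case by (auto intro: continuous_intros)
next
  case (Suc k)
  show ?case
    by (rule Ck_SucI[OF has_derivative_mult[OF Ck_SucD(1)[OF Suc.prems(1)] Ck_SucD(1)[OF Suc.prems(2)]]])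
      (intro Ck_add Suc.IH Ck_SucD(2) Suc.prems Suc.prems[THEN Ck_Suc_imp_Ck])
qed

text \<open>Only the values of the outer function and of its derivative along \<open>u\<close> enter, so the outer
  function may be singular off the range of \<open>u\<close>; this is what covers powers of positive functions.
  The rule raises the order by one step, and is meant for families of outer functions that are
  closed under differentiation.\<close>

lemma Ck_chain:
  assumes "\<And>y. (\<phi> has_real_derivative \<psi> (u y)) (at (u y))"
    and "Ck (Suc k) u" and "Ck k (\<lambda>y. \<psi> (u y))"
  shows "Ck (Suc k) (\<lambda>y. \<phi> (u y))"
  by (rule Ck_SucI[OF DERIV_compose_FDERIV[OF assms(1) Ck_SucD(1)[OF assms(2)]]])
    (intro Ck_mult Ck_SucD(2)[OF assms(2)] assms(3))

lemma Ck_powr: "Ck k u \<Longrightarrow> (\<And>y. u y > 0) \<Longrightarrow> Ck k (\<lambda>y. u y powr a)"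
proof (induction k arbitrary: a)
  case 0
  then show ?case by (auto intro!: continuous_intros simp: less_imp_neq[THEN not_sym])
next
  case (Suc k)
  show ?case
  proof (rule Ck_chain[where \<phi> = "\<lambda>x. x powr a" and \<psi> = "\<lambda>x. a * x powr (a - 1)"])
    show "((\<lambda>x. x powr a) has_real_derivative a * u y powr (a - 1)) (at (u y))" for y
      using has_real_derivative_powr[of "u y" a] Suc.prems(2)[of y] by simp
    show "Ck k (\<lambda>y. a * u y powr (a - 1))"
      by (rule Ck_mult[OF Ck_const Suc.IH[OF Ck_Suc_imp_Ck[OF Suc.prems(1)] Suc.prems(2)]])
  qed (rule Suc.prems)
qed

lemma Ck_coord: "Ck k (\<lambda>y. y $ i)"
proof (cases k)
  case (Suc j)
  show ?thesis unfolding Suc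
    by (rule Ck_SucI[OF bounded_linear_imp_has_derivative[OF bounded_linear_vec_nth]]) (rule Ck_const)
qed (auto intro: continuous_intros)

named_theorems smooth_intros

lemma C_infinity_const [smooth_intros]: "C_infinity (\<lambda>y. c)"
  and C_infinity_coord [smooth_intros]: "C_infinity (\<lambda>y. y $ i)"
  and C_infinity_add [smooth_intros]: "C_infinity f \<Longrightarrow> C_infinity g \<Longrightarrow> C_infinity (\<lambda>y. f y + g y)"
  and C_infinity_mult [smooth_intros]: "C_infinity f \<Longrightarrow> C_infinity g \<Longrightarrow> C_infinity (\<lambda>y. f y * g y)"
  and C_infinity_powr: "C_infinity f \<Longrightarrow> (\<And>y. f y > 0) \<Longrightarrow> C_infinity (\<lambda>y. f y powr a)"
  by (auto simp: C_infinity_def intro: Ck_const Ck_coord Ck_add Ck_mult Ck_powr)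

lemma C_infinity_minus [smooth_intros]: "C_infinity f \<Longrightarrow> C_infinity (\<lambda>y. - f y)"
  using C_infinity_mult[OF C_infinity_const[of "-1"]] by simp

lemma C_infinity_diff [smooth_intros]:
  "C_infinity f \<Longrightarrow> C_infinity g \<Longrightarrow> C_infinity (\<lambda>y. f y - g y)"
  using C_infinity_add[of f "\<lambda>y. - g y"] C_infinity_minus[of g] by simp

lemma C_infinity_power [smooth_intros]: "C_infinity f \<Longrightarrow> C_infinity (\<lambda>y. f y ^ n)"
  by (induction n) (auto intro: smooth_intros)

lemma C_infinity_divide:
  assumes "C_infinity f" "C_infinity g" "\<And>y. g y > 0"
  shows "C_infinity (\<lambda>y. f y / g y)"
proof -
  have "g y powr (- 1) = inverse (g y)" for y
    using powr_minus[of "g y" 1] assms(3)[of y] by simp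
  then show ?thesis
    using C_infinity_mult[OF assms(1) C_infinity_powr[OF assms(2,3), of "- 1"]]
    by (simp add: divide_inverse)
qed

section \<open>Smooth functions that are flat at the origin\<close>

text \<open>The functions \<open>z\<^sup>n exp (-\<kappa>/z\<^sup>2)\<close>, extended by 0. Negative exponents \<open>n\<close> are
  included so that the family is closed under differentiation up to linear combinations, and
  \<open>\<kappa>\<close> is complex so that the real parts include oscillating factors such as \<open>sin (\<epsilon>/z\<^sup>2)\<close>.\<close>

definition flat :: "complex \<Rightarrow> int \<Rightarrow> real \<Rightarrow> complex" where
  "flat \<kappa> n z = (if z = 0 then 0 else of_real (z powi n) * exp (- \<kappa> / of_real (z\<^sup>2)))"

text \<open>A single term of the exponential series is at most its sum.\<close>

lemma power_times_exp_minus_le: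
  fixes w a :: real
  assumes "a > 0" "w \<ge> 0"
  shows "w ^ N * exp (- (a * w)) \<le> fact N / a ^ N"
proof -
  have "(a * w) ^ N /\<^sub>R fact N \<le> exp (a * w)"
    unfolding exp_def
    using sum_le_suminf[OF summable_exp_generic[of "a * w"], of "{N}"] assms by simp
  then show ?thesis
    using assms by (simp add: exp_minus field_simps power_mult_distrib)
qed

text \<open>The factor \<open>exp (-\<kappa>/z\<^sup>2)\<close> beats every power of \<open>1/z\<^sup>2\<close>, so any negative exponent \<open>n\<close> can be
  absorbed with one power of \<open>z\<close> to spare.\<close>

lemma norm_flat_le:
  assumes "Re \<kappa> > 0"
  obtains K where "\<And>z. \<bar>z\<bar> < 1 \<Longrightarrow> norm (flat \<kappa> n z) \<le> K * \<bar>z\<bar>"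
proof
  define N where "N = Suc (nat \<bar>n\<bar>)"
  fix z :: real assume z: "\<bar>z\<bar> < 1"
  show "norm (flat \<kappa> n z) \<le> fact N / Re \<kappa> ^ N * \<bar>z\<bar>"
  proof (cases "z = 0")
    case False
    \<comment> \<open>Estimate \<open>|z|\<^sup>n\<close> by \<open>|z| w\<^sup>N\<close> with \<open>w = 1/z\<^sup>2\<close>, which is possible since \<open>n \<ge> 1 - 2N\<close>.\<close>
    define w where "w = inverse (z\<^sup>2)"
    have w: "w \<ge> 0" by (simp add: w_def)
    have "\<bar>z\<bar> powi n \<le> \<bar>z\<bar> powi (1 - 2 * int N)"
      using z False by (intro power_int_decreasing) (auto simp: N_def)
    also have "\<dots> = \<bar>z\<bar> * w ^ N"
      using False by (simp add: w_def power_int_diff power_int_mult divide_inverse power_inverse)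
    finally have le: "\<bar>z\<bar> powi n \<le> \<bar>z\<bar> * w ^ N" .
    have "norm (flat \<kappa> n z) = \<bar>z\<bar> powi n * exp (- (Re \<kappa> * w))"
      using False by (simp add: flat_def norm_mult w_def norm_power_int divide_inverse power_int_abs
        flip: of_real_power of_real_inverse)
    also have "\<dots> \<le> \<bar>z\<bar> * w ^ N * exp (- (Re \<kappa> * w))"
      using le by (simp add: mult_right_mono)
    also have "\<dots> \<le> \<bar>z\<bar> * (fact N / Re \<kappa> ^ N)"
      unfolding mult.assoc
      by (rule mult_left_mono[OF power_times_exp_minus_le[OF assms w]]) simp
    finally show ?thesis by (simp add: mult.commute)
  qed (simp add: flat_def)
qed

lemma flat_tendsto_0:
  assumes "Re \<kappa> > 0"
  shows "(flat \<kappa> n \<longlongrightarrow> 0) (at 0)"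
proof -
  obtain K where K: "\<And>z. \<bar>z\<bar> < 1 \<Longrightarrow> norm (flat \<kappa> n z) \<le> K * \<bar>z\<bar>"
    by (rule norm_flat_le[OF assms, of n]) (rule that)
  have "eventually (\<lambda>z. norm (flat \<kappa> n z) \<le> K * \<bar>z\<bar>) (at (0::real))"
    unfolding eventually_at by (rule exI[of _ 1]) (auto intro: K)
  moreover have "((\<lambda>z. K * \<bar>z\<bar>) \<longlongrightarrow> 0) (at (0::real))"
    by (auto intro!: tendsto_eq_intros)
  ultimately show ?thesis by (rule Lim_null_comparison)
qed

definition flat_deriv :: "complex \<Rightarrow> int \<Rightarrow> real \<Rightarrow> complex" where
  "flat_deriv \<kappa> n z = of_int n * flat \<kappa> (n - 1) z + 2 * \<kappa> * flat \<kappa> (n - 3) z"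

text \<open>At the origin the difference quotient of the member with exponent \<open>n\<close> is the member with
  exponent \<open>n - 1\<close>, which tends to 0.\<close>

lemma flat_has_vector_derivative:
  assumes "Re \<kappa> > 0"
  shows "(flat \<kappa> n has_vector_derivative flat_deriv \<kappa> n z) (at z)"
proof (cases "z = 0")
  case True
  have "((\<lambda>h. flat \<kappa> n h /\<^sub>R h) \<longlongrightarrow> 0) (at 0)"
  proof (rule Lim_transform_eventually[OF flat_tendsto_0[OF assms, of "n - 1"]])
    show "\<forall>\<^sub>F h in at 0. flat \<kappa> (n - 1) h = flat \<kappa> n h /\<^sub>R h"
      by (auto simp: eventually_at flat_def power_int_diff scaleR_conv_of_real divide_inverse
          intro!: exI[of _ 1])
  qed
  then have "(flat \<kappa> n has_vector_derivative 0) (at 0)"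
    unfolding has_vector_derivative_def has_derivative_at
    using tendsto_norm[of "\<lambda>h. flat \<kappa> n h /\<^sub>R h" 0 "at 0"]
    by (simp add: flat_def divide_inverse mult.commute)
  then show ?thesis using True by (simp add: flat_deriv_def flat_def)
next
  case False
  have "((\<lambda>x. x powi n * exp (- \<kappa> / x\<^sup>2)) has_field_derivative
     of_int n * of_real (z powi (n - 1)) * exp (- \<kappa> / of_real (z\<^sup>2))
      + 2 * \<kappa> * of_real (z powi (n - 3)) * exp (- \<kappa> / of_real (z\<^sup>2))) (at (of_real z))"
    using False
    by (auto intro!: derivative_eq_intros simp: field_simps power_int_diff power2_eq_square power3_eq_cube)
  from has_vector_derivative_real_field[OF this]
  have "((\<lambda>x. of_real (x powi n) * exp (- \<kappa> / of_real (x\<^sup>2))) has_vector_derivative flat_deriv \<kappa> n z) (at z)"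
    using False by (simp add: flat_deriv_def flat_def mult.assoc)
  moreover have "open (- {0::real})" by auto
  ultimately show ?thesis
    using False by (subst has_vector_derivative_transform_within_open[of _ _ z "- {0}"])
      (auto simp: flat_def)
qed

lemma Re_has_real_derivative:
  "(f has_vector_derivative f') (at z) \<Longrightarrow> ((\<lambda>z. Re (c * f z)) has_real_derivative Re (c * f')) (at z)"
  unfolding has_real_derivative_iff_has_vector_derivative
  by (rule bounded_linear.has_vector_derivative[OF bounded_linear_compose[OF bounded_linear_Re bounded_linear_mult_right]])

lemmas flat_has_real_derivative = Re_has_real_derivative[OF flat_has_vector_derivative]

lemma Re_flat_deriv_has_real_derivative:
  assumes "Re \<kappa> > 0"
  shows "((\<lambda>z. Re (c * flat_deriv \<kappa> n z)) has_real_derivative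
    Re (c * (of_int n * flat_deriv \<kappa> (n - 1) z + 2 * \<kappa> * flat_deriv \<kappa> (n - 3) z))) (at z)"
proof -
  have unf: "flat_deriv \<kappa> n = (\<lambda>z. of_int n * flat \<kappa> (n - 1) z + 2 * \<kappa> * flat \<kappa> (n - 3) z)"
    by (rule ext) (rule flat_deriv_def)
  have "(flat_deriv \<kappa> n has_vector_derivative
      of_int n * flat_deriv \<kappa> (n - 1) z + 2 * \<kappa> * flat_deriv \<kappa> (n - 3) z) (at z)"
    unfolding unf
    by (intro has_vector_derivative_add has_vector_derivative_mult_right
        flat_has_vector_derivative[OF assms])
  then show ?thesis by (rule Re_has_real_derivative)
qed

lemma Re_flat_deriv:
  "Re (c * flat_deriv \<kappa> n z) =
    Re ((c * of_int n) * flat \<kappa> (n - 1) z) + Re ((c * (2 * \<kappa>)) * flat \<kappa> (n - 3) z)"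
  by (simp only: flat_deriv_def distrib_left mult.assoc plus_complex.sel)

text \<open>The induction runs over all exponents and coefficients at once, because differentiation
  leads from one exponent to two smaller ones.\<close>

lemma Ck_flat:
  assumes "Re \<kappa> > 0"
  shows "Ck k u \<Longrightarrow> Ck k (\<lambda>y. Re (c * flat \<kappa> n (u y)))"
proof (induction k arbitrary: c n)
  case 0
  have "isCont (\<lambda>z. Re (c * flat \<kappa> n z)) z" for z
    using flat_has_real_derivative[OF assms] by (rule DERIV_isCont)
  then have "continuous_on UNIV (\<lambda>z. Re (c * flat \<kappa> n z))"
    by (simp add: continuous_at_imp_continuous_on)
  from continuous_on_compose2[OF this, of UNIV u] 0 show ?case by simp
next
  case (Suc k)
  show ?case
  proof (rule Ck_chain[OF flat_has_real_derivative[OF assms] Suc.prems])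
    show "Ck k (\<lambda>y. Re (c * flat_deriv \<kappa> n (u y)))"
      unfolding Re_flat_deriv by (intro Ck_add Suc.IH Ck_Suc_imp_Ck[OF Suc.prems])
  qed
qed

lemma C_infinity_flat: "Re \<kappa> > 0 \<Longrightarrow> C_infinity u \<Longrightarrow> C_infinity (\<lambda>y. Re (c * flat \<kappa> n (u y)))"
  unfolding C_infinity_def using Ck_flat by blast

lemma C_infinity_flat_deriv:
  assumes "Re \<kappa> > 0" "C_infinity u"
  shows "C_infinity (\<lambda>y. Re (c * flat_deriv \<kappa> n (u y)))"
  unfolding Re_flat_deriv by (intro C_infinity_add C_infinity_flat assms)

section \<open>Conformal metrics in stereographic coordinates\<close>

lemma matrix_inv_mat_2:
  fixes c :: real
  assumes "c \<noteq> 0"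
  shows "matrix_inv (mat c :: real^2^2) = mat (inverse c)"
proof -
  have mul: "mat a ** mat b = (mat (a * b) :: real^2^2)" for a b :: real
    by (simp add: vec_eq_iff forall_2 matrix_matrix_mult_def sum_2 mat_def)
  have inv: "mat c ** mat (inverse c) = (mat 1 :: real^2^2)" "mat (inverse c) ** mat c = (mat 1 :: real^2^2)"
    using assms by (simp_all add: mul)
  then have "matrix_inv (mat c) ** mat c = (mat 1 :: real^2^2)"
    unfolding matrix_inv_def
    by (rule someI2[of _ "mat (inverse c)", OF conjI]) simp
  then have "matrix_inv (mat c) ** (mat c ** mat (inverse c)) = (mat (inverse c) :: real^2^2)"
    by (simp add: matrix_mul_assoc)
  then show ?thesis by (simp add: inv)
qed

lemma gram_conformal:
  assumes "s \<in> {1, -1}"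
  shows "gram (conformal_metric G round_metric) s y = mat (G (stereo s y) * (4 / (1 + (norm y)\<^sup>2)\<^sup>2))"
proof -
  have "gram (conformal_metric G round_metric) s y $ i $ j = G (stereo s y) * gram round_metric s y $ i $ j" for i j
    by (simp add: gram_def conformal_metric_def)
  then show ?thesis
    unfolding gram_round_metric[OF assms] by (simp add: vec_eq_iff mat_def)
qed

lemma one_plus_norm_pos: "1 + (norm (y::real^2))\<^sup>2 > 0"
  by (rule add_pos_nonneg) auto

text \<open>In dimension two the square root of the Gram determinant cancels against the inverse Gram
  matrix: both stereographic charts are conformal, so the Gram matrix is \<open>\<rho>\<close> times the identity and
  the flux \<open>\<rho> \<cdot> (1/\<rho>) \<nabla>f\<close> is the Euclidean gradient. Hence the operator is \<open>1/\<rho>\<close> times the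
  planar Laplacian, for every function \<open>f\<close>.\<close>

lemma laplace_beltrami_coord_conformal:
  assumes s: "s \<in> {1, -1}" and G: "\<And>p. p \<in> S2 \<Longrightarrow> G p > 0"
  shows "laplace_beltrami_coord (conformal_metric G round_metric) s f y =
    inverse (G (stereo s y)) * ((1 + (norm y)\<^sup>2)\<^sup>2 / 4) *
      (\<Sum>i\<in>UNIV. partial_deriv i (partial_deriv i (\<lambda>x. f (stereo s x))) y)"
proof -
  define \<rho> where "\<rho> z = G (stereo s z) * (4 / (1 + (norm z)\<^sup>2)\<^sup>2)" for z
  have pos: "\<rho> z > 0" for z
    using G[OF stereo_in_S2[OF s]] one_plus_norm_pos[of z] by (simp add: \<rho>_def)
  have "det (mat (\<rho> z) :: real^2^2) = (\<rho> z)\<^sup>2" for z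
    by (simp add: det_2 mat_def power2_eq_square)
  then have sqrt: "sqrt (det (mat (\<rho> z) :: real^2^2)) = \<rho> z" for z
    using pos[of z] by simp
  have "\<rho> z \<noteq> 0" for z using pos[of z] by simp
  note inv = matrix_inv_mat_2[OF this]
  have sel: "\<rho> z * (\<Sum>j\<in>UNIV. (mat (inverse (\<rho> z)) :: real^2^2) $ i $ j * w j) = w i" for w z i
    using pos[of z] exhaust_2[of i] by (auto simp: sum_2 mat_def)
  show ?thesis
    unfolding laplace_beltrami_coord_def gram_conformal[OF s] \<rho>_def[symmetric] sqrt inv sel
    unfolding \<rho>_def[of y] inverse_eq_divide
    by (simp only: divide_divide_eq_right mult.commute mult_1_left times_divide_eq_right times_divide_eq_left divide_divide_eq_left)
qed

lemma laplace_beltrami_coord_round: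
  assumes "s \<in> {1, -1}"
  shows "laplace_beltrami_coord round_metric s f y =
    (1 + (norm y)\<^sup>2)\<^sup>2 / 4 * (\<Sum>i\<in>UNIV. partial_deriv i (partial_deriv i (\<lambda>x. f (stereo s x))) y)"
proof -
  have "round_metric = conformal_metric (\<lambda>_. 1) round_metric"
    by (simp add: conformal_metric_def fun_eq_iff)
  with laplace_beltrami_coord_conformal[OF assms, where G = "\<lambda>_. 1" and f = f and y = y]
  show ?thesis by (simp only: zero_less_one inverse_1 mult_1_left)
qed

lemma laplace_beltrami_conformal:
  assumes "\<And>p. p \<in> S2 \<Longrightarrow> G p > 0" "p \<in> S2"
  shows "laplace_beltrami (conformal_metric G round_metric) f p =
    inverse (G p) * laplace_beltrami round_metric f p"
proof -
  define s :: real where "s = (if p$3 = 1 then -1 else 1)"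
  have s: "s \<in> {1, -1}" "s * p$3 \<noteq> 1" by (auto simp: s_def)
  have p: "stereo s (stereo_chart s p) = p"
    by (rule stereo_stereo_chart[OF s(1) assms(2) s(2)])
  have "laplace_beltrami_coord (conformal_metric G round_metric) s f (stereo_chart s p) =
    inverse (G p) * laplace_beltrami_coord round_metric s f (stereo_chart s p)"
    using laplace_beltrami_coord_conformal[OF s(1), where G = G and f = f and y = "stereo_chart s p"]
      assms(1)
    by (simp only: p laplace_beltrami_coord_round[OF s(1)] mult.assoc)
  then show ?thesis
    unfolding laplace_beltrami_def s_def[symmetric] Let_def .
qed

lemma riemannian_metric_conformal:
  assumes pos: "\<And>p. p \<in> S2 \<Longrightarrow> G p > 0" and smooth: "smooth_on_S2 G"
  shows "riemannian_metric (conformal_metric G round_metric)"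
  unfolding riemannian_metric_def
proof (intro conjI ballI allI impI)
  fix s :: real and i j :: 2 assume s: "s \<in> {1, -1}"
  have "C_infinity (\<lambda>y. G (stereo s y) * (4 / (1 + ((y $ 1)\<^sup>2 + (y $ 2)\<^sup>2))\<^sup>2))"
    by (intro smooth_intros C_infinity_divide zero_less_power)
      (use smooth s in \<open>auto simp: smooth_on_S2_def add_pos_nonneg\<close>)
  then have "C_infinity (\<lambda>y. G (stereo s y) * (4 / (1 + (norm y)\<^sup>2)\<^sup>2))"
    by (simp only: norm2_sq)
  then show "C_infinity (\<lambda>y. gram (conformal_metric G round_metric) s y $ i $ j)"
    unfolding gram_conformal[OF s] by (cases "i = j") (simp_all add: mat_def C_infinity_const)
qed (use pos in \<open>auto simp: conformal_metric_def round_metric_def inner_commute algebra_simps inner_add_left\<close>)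

section \<open>Sectoral harmonics times functions of the height\<close>

definition zeta :: "real^2 \<Rightarrow> complex" where
  "zeta y = Complex (y$1) (y$2)"

lemma zeta_bounded_linear: "bounded_linear zeta"
  by (rule linear_conv_bounded_linear[THEN iffD1], rule linearI)
    (simp_all add: zeta_def complex_eq_iff)

lemma Re_zeta_power_has_derivative:
  "((\<lambda>y. Re (c * zeta y ^ n)) has_derivative
     (\<lambda>v. Re ((c * of_nat n * zeta v) * zeta y ^ (n - 1)))) (at y)"
proof -
  have "(zeta has_derivative zeta) (at y)"
    by (rule bounded_linear_imp_has_derivative[OF zeta_bounded_linear])
  then show ?thesis
    by (auto intro!: derivative_eq_intros simp: algebra_simps)
qed

text \<open>Partial derivatives of \<open>Re (c \<zeta>\<^sup>n)\<close> have the same form with another coefficient \<open>c\<close>.\<close>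

lemma C_infinity_Re_zeta_power [smooth_intros]: "C_infinity (\<lambda>y. Re (c * zeta y ^ n))"
proof -
  have "Ck k (\<lambda>y. Re (c * zeta y ^ n))" for k
  proof (induction k arbitrary: c n)
    case 0
    show ?case
      by (auto intro!: continuous_intros bounded_linear.continuous_on[OF zeta_bounded_linear])
  next
    case (Suc k)
    show ?case by (rule Ck_SucI[OF Re_zeta_power_has_derivative]) (rule Suc.IH)
  qed
  then show ?thesis by (simp add: C_infinity_def)
qed

lemma stereo_height: "stereo s y $ 3 = s * (y \<bullet> y - 1) / (1 + y \<bullet> y)"
  by (simp add: stereo_def power2_norm_eq_inner)

lemma one_plus_inner_pos: "1 + y \<bullet> y > (0::real)"
  by (rule add_pos_nonneg) auto

lemma C_infinity_stereo_height: "C_infinity (\<lambda>y. stereo s y $ 3)"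
proof -
  have "C_infinity (\<lambda>y::real^2. s * (y $ 1 * y $ 1 + y $ 2 * y $ 2 - 1) / (1 + (y $ 1 * y $ 1 + y $ 2 * y $ 2)))"
    by (intro C_infinity_divide smooth_intros) (simp add: add_pos_nonneg)
  then show ?thesis unfolding stereo_height by (simp add: inner_vec_def sum_2)
qed

lemma one_minus_height:
  assumes "s \<in> {1, -1}"
  shows "1 - s * stereo s y $ 3 = 2 / (1 + y \<bullet> y)"
  using assms one_plus_inner_pos[of y] by (auto simp: stereo_height field_simps)

text \<open>Stereographic projection preserves longitude, so on the sphere \<open>x + iy\<close> is a multiple of the
  planar coordinate, and the factor depends on the height only. The sectoral harmonic therefore
  becomes a function of the height times the harmonic polynomial \<open>Re (\<zeta>\<^sup>m)\<close>.\<close>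

lemma Complex_stereo:
  assumes "s \<in> {1, -1}"
  shows "Complex (stereo s y $ 1) (stereo s y $ 2) = of_real (1 - s * stereo s y $ 3) * zeta y"
  unfolding one_minus_height[OF assms]
  by (simp add: stereo_def zeta_def complex_eq_iff power2_norm_eq_inner)

lemma inverse_one_plus_inner_has_derivative:
  fixes y :: "real^2"
  shows "((\<lambda>y. inverse (1 + y \<bullet> y)) has_derivative (\<lambda>v. - 2 * (y \<bullet> v) * (inverse (1 + y \<bullet> y))\<^sup>2)) (at y)"
proof -
  have *: "1 + y \<bullet> y \<noteq> 0" using one_plus_inner_pos[of y] by simp
  show ?thesis
    by (rule derivative_eq_intros refl *)+
      (simp add: fun_eq_iff inner_commute power2_eq_square)
qed

lemma stereo_height_has_derivative:
  "((\<lambda>y. stereo s y $ 3) has_derivative (\<lambda>v. 4 * s * (y \<bullet> v) * (inverse (1 + y \<bullet> y))\<^sup>2)) (at y)"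
proof -
  define u where "u = inverse (1 + y \<bullet> y)"
  have u: "u * (1 + y \<bullet> y) = 1" using one_plus_inner_pos[of y] by (simp add: u_def)
  have "((\<lambda>y. s * (y \<bullet> y - 1)) has_derivative (\<lambda>v. s * (2 * (y \<bullet> v)))) (at y)"
    by (rule derivative_eq_intros refl)+ (simp add: fun_eq_iff inner_commute)
  from has_derivative_mult[OF this inverse_one_plus_inner_has_derivative]
  have "((\<lambda>y. s * (y \<bullet> y - 1) * inverse (1 + y \<bullet> y)) has_derivative
      (\<lambda>v. 4 * s * (y \<bullet> v) * u\<^sup>2)) (at y)"
    unfolding u_def[symmetric]
    by (rule has_derivative_eq_rhs) (rule ext, use u in algebra)
  then show ?thesis by (simp add: stereo_height divide_inverse u_def)
qed

text \<open>In the product rule the term with the Laplacian of \<open>Re (\<zeta>\<^sup>m)\<close> vanishes, and since the gradient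
  of the height is radial, the mixed term is given by Euler's identity for homogeneous functions of
  degree \<open>m\<close>. The remaining ingredients are the eikonal identity \<open>|\<nabla>Z|\<^sup>2 = \<rho> (1 - Z\<^sup>2)\<close> and the
  eigenvalue equation \<open>\<Delta>Z = -2 \<rho> Z\<close> of the height, with \<open>\<rho> = 4/(1 + |y|\<^sup>2)\<^sup>2\<close>.\<close>

lemma laplacian_height_times_harmonic:
  fixes k k1 k2 :: "real \<Rightarrow> real"
  assumes s: "s \<in> {1, -1}"
    and k1: "\<And>z. s * z < 1 \<Longrightarrow> (k has_real_derivative k1 z) (at z)"
    and k2: "\<And>z. s * z < 1 \<Longrightarrow> (k1 has_real_derivative k2 z) (at z)"
  defines "Z \<equiv> \<lambda>y. stereo s y $ 3"
  shows "(\<Sum>i\<in>UNIV. partial_deriv i (partial_deriv i (\<lambda>y. k (Z y) * Re (zeta y ^ m))) y) =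
    4 / (1 + y \<bullet> y)\<^sup>2 * (((1 - (Z y)\<^sup>2) * k2 (Z y) - 2 * Z y * k1 (Z y)
       + 2 * s * real m * k1 (Z y)) * Re (zeta y ^ m))"
proof -
  \<comment> \<open>\<open>q\<close> is the conformal weight \<open>\<surd>\<rho>/2\<close>, and \<open>d i\<close> the partial derivative of \<open>h\<close>.\<close>
  define q where "q y = inverse (1 + y \<bullet> y)" for y :: "real^2"
  define h where "h y = Re (zeta y ^ m)" for y
  define d where "d i y = Re ((of_nat m * zeta (axis i 1)) * zeta y ^ (m - 1))" for i y
  have Zlt: "s * Z y < 1" for y
    using one_minus_height[OF s, of y] one_plus_inner_pos[of y] unfolding Z_def
    by (smt (verit) divide_pos_pos)
  have Z: "(Z has_derivative (\<lambda>v. 4 * s * (y \<bullet> v) * (q y)\<^sup>2)) (at y)" for y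
    unfolding Z_def q_def by (rule stereo_height_has_derivative)
  have q: "(q has_derivative (\<lambda>v. - 2 * (y \<bullet> v) * (q y)\<^sup>2)) (at y)" for y
    unfolding q_def by (rule inverse_one_plus_inner_has_derivative)
  have h: "(h has_derivative (\<lambda>v. Re ((of_nat m * zeta v) * zeta y ^ (m - 1)))) (at y)" for y
    unfolding h_def using Re_zeta_power_has_derivative[of 1 m y] by simp
  have kZ: "((\<lambda>y. k (Z y)) has_derivative (\<lambda>v. k1 (Z y) * (4 * s * (y \<bullet> v) * (q y)\<^sup>2))) (at y)" for y
    using DERIV_compose_FDERIV[OF k1[OF Zlt] Z] by (simp add: mult.commute)
  have k1Z: "((\<lambda>y. k1 (Z y)) has_derivative (\<lambda>v. k2 (Z y) * (4 * s * (y \<bullet> v) * (q y)\<^sup>2))) (at y)" for y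
    using DERIV_compose_FDERIV[OF k2[OF Zlt] Z] by (simp add: mult.commute)
  have d: "(d i has_derivative (\<lambda>v. Re (((of_nat m * zeta (axis i 1)) * of_nat (m - 1) * zeta v) *
      zeta y ^ (m - 1 - 1)))) (at y)" for i y
    unfolding d_def by (rule Re_zeta_power_has_derivative)
  have coord: "((\<lambda>y. y $ i) has_derivative (\<lambda>v. v $ i)) (at y)" for i and y :: "real^2"
    by (rule bounded_linear_imp_has_derivative[OF bounded_linear_vec_nth])
  have pd1: "partial_deriv i (\<lambda>y. k (Z y) * h y) =
      (\<lambda>y. k (Z y) * d i y + k1 (Z y) * (4 * s * y $ i * (q y)\<^sup>2) * h y)" for i
    by (rule ext, subst partial_deriv_eq[OF has_derivative_mult[OF kZ h]])
      (simp add: d_def inner_axis)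
  have pd2: "partial_deriv i (\<lambda>y. k (Z y) * d i y + k1 (Z y) * (4 * s * y $ i * (q y)\<^sup>2) * h y) y =
      k (Z y) * Re (of_nat m * of_nat (m - 1) * (zeta (axis i 1))\<^sup>2 * zeta y ^ (m - 1 - 1))
      + 2 * k1 (Z y) * (4 * s * y $ i * (q y)\<^sup>2) * d i y
      + k2 (Z y) * (4 * s * y $ i * (q y)\<^sup>2)\<^sup>2 * h y
      + k1 (Z y) * (4 * s * (q y)\<^sup>2 - 16 * s * (y $ i)\<^sup>2 * (q y)^3) * h y" for i
    by (rule partial_deriv_eq[THEN trans],
        (rule derivative_eq_intros kZ k1Z d h q coord refl)+)
      (simp add: d_def inner_axis power2_eq_square power3_eq_cube algebra_simps)
  have ax: "zeta (axis 1 1) = 1" "zeta (axis 2 1) = \<i>"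
    by (simp_all add: zeta_def axis_def complex_eq_iff)
  have euler: "y $ 1 * d 1 y + y $ 2 * d 2 y = real m * h y"
  proof (cases m)
    case (Suc n)
    then show ?thesis by (simp add: d_def h_def ax) (simp add: zeta_def algebra_simps)
  qed (simp add: d_def h_def)
  define N where "N = (y $ 1)\<^sup>2 + (y $ 2)\<^sup>2"
  have N: "y \<bullet> y = N" by (simp add: N_def inner_vec_def sum_2 power2_eq_square)
  have qN: "q y * (1 + N) = 1"
    using one_plus_inner_pos[of y] by (simp add: q_def N)
  have ZN: "Z y = s * (N - 1) * q y"
    by (simp add: Z_def stereo_height q_def N divide_inverse)
  have ss: "s * s = 1" using s by auto
  have Z1: "1 - (Z y)\<^sup>2 = 4 * N * (q y)\<^sup>2"
    using qN ss unfolding ZN by algebra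
  have Z2: "8 * s * (q y)\<^sup>2 - 16 * s * N * (q y)^3 = - 8 * Z y * (q y)\<^sup>2"
    using qN unfolding ZN by algebra
  \<comment> \<open>The second derivatives of \<open>h\<close> cancel in the sum, because the squares of \<open>1\<close> and \<open>\<i>\<close> do.\<close>
  have "(\<Sum>i\<in>UNIV. partial_deriv i (partial_deriv i (\<lambda>y. k (Z y) * h y)) y) =
    8 * s * (q y)\<^sup>2 * k1 (Z y) * (y $ 1 * d 1 y + y $ 2 * d 2 y)
    + k2 (Z y) * (16 * (s * s) * N * (q y)^4) * h y
    + k1 (Z y) * (8 * s * (q y)\<^sup>2 - 16 * s * N * (q y)^3) * h y"
    unfolding pd1 sum_2 pd2 ax N_def
    by (simp add: algebra_simps power2_eq_square power3_eq_cube power4_eq_xxxx)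
  also have "\<dots> = 4 * (q y)\<^sup>2 * (((1 - (Z y)\<^sup>2) * k2 (Z y) - 2 * Z y * k1 (Z y)
       + 2 * s * real m * k1 (Z y)) * h y)"
    unfolding euler Z1 Z2 ss by algebra
  finally show ?thesis
    by (simp add: h_def q_def divide_inverse power_inverse)
qed

lemma one_minus_power_has_derivative:
  fixes s z :: real
  assumes "s * z < 1"
  shows "((\<lambda>z. (1 - s * z) ^ m) has_real_derivative - (s * real m * (1 - s * z) ^ m / (1 - s * z))) (at z)"
proof -
  have "((\<lambda>z. 1 - s * z) has_real_derivative - s) (at z)"
    by (auto intro!: derivative_eq_intros)
  from DERIV_power[OF this, of m] show ?thesis
    by (rule DERIV_cong) (use assms in \<open>cases m; simp\<close>)
qed

text \<open>For \<open>H = 1\<close> this is the eigenvalue equation of the sectoral harmonic of degree \<open>m\<close>. In the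
  chart the product becomes \<open>k (Z) Re (\<zeta>\<^sup>m)\<close> with \<open>k (z) = (1 - s z)\<^sup>m H (z)\<close>; the dependence on the
  chart disappears when the derivatives of \<open>k\<close> are expressed through those of \<open>H\<close>.\<close>

lemma laplace_beltrami_height_times_sectoral:
  fixes H H1 H2 :: "real \<Rightarrow> real"
  assumes H1: "\<And>z. (H has_real_derivative H1 z) (at z)"
    and H2: "\<And>z. (H1 has_real_derivative H2 z) (at z)"
    and p: "p \<in> S2"
  shows "laplace_beltrami round_metric (\<lambda>p. H (p$3) * Re (Complex (p$1) (p$2) ^ m)) p =
    ((1 - (p$3)\<^sup>2) * H2 (p$3) - 2 * (real m + 1) * p$3 * H1 (p$3)
      - real m * (real m + 1) * H (p$3)) * Re (Complex (p$1) (p$2) ^ m)"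
proof -
  \<comment> \<open>The chart prescribed by the definition of the operator at \<open>p\<close>.\<close>
  define s :: real where "s = (if p$3 = 1 then -1 else 1)"
  define y where "y = stereo_chart s p"
  have s: "s \<in> {1, -1}" "s * p$3 \<noteq> 1" by (auto simp: s_def)
  have py: "stereo s y = p"
    unfolding y_def by (rule stereo_stereo_chart[OF s(1) p s(2)])
  have ss: "s * s = 1" using s by auto
  define k where "k z = (1 - s * z) ^ m * H z" for z
  define k1 where "k1 z = (1 - s * z) ^ m * (H1 z - s * real m * H z / (1 - s * z))" for z
  define k2 where "k2 z = (1 - s * z) ^ m *
    (H2 z - 2 * s * real m * H1 z / (1 - s * z) + real m * (real m - 1) * H z / (1 - s * z)\<^sup>2)" for z
  have "(k has_real_derivative k1 z) (at z)" if "s * z < 1" for z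
    unfolding k_def k1_def
    by (rule derivative_eq_intros H1 one_minus_power_has_derivative[OF that] refl)+
      (use that in \<open>simp add: field_simps\<close>)
  moreover have "(k1 has_real_derivative k2 z) (at z)" if "s * z < 1" for z
  proof -
    define u where "u = inverse (1 - s * z)"
    have nz: "1 - s * z \<noteq> 0" using that by simp
    have "((\<lambda>z. H1 z - s * real m * H z / (1 - s * z)) has_real_derivative
        H2 z - s * real m * (H1 z * u + s * H z * u\<^sup>2)) (at z)"
      using nz by (auto intro!: derivative_eq_intros H1 H2 simp: u_def divide_inverse)
        (simp add: field_simps power2_eq_square)
    from DERIV_mult[OF one_minus_power_has_derivative[OF that, of m] this]
    have "((\<lambda>z. (1 - s * z) ^ m * (H1 z - s * real m * H z / (1 - s * z))) has_real_derivative k2 z) (at z)"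
    proof (rule DERIV_cong)
      define Q where "Q = (1 - s * z) ^ m"
      show "- (s * real m * (1 - s * z) ^ m / (1 - s * z)) * (H1 z - s * real m * H z / (1 - s * z)) +
        (H2 z - s * real m * (H1 z * u + s * H z * u\<^sup>2)) * (1 - s * z) ^ m = k2 z"
        unfolding k2_def divide_inverse power_inverse[symmetric] u_def[symmetric] Q_def[symmetric]
        using ss by algebra
    qed
    then show ?thesis unfolding k1_def .
  qed
  ultimately have lap: "(\<Sum>i\<in>UNIV. partial_deriv i (partial_deriv i
       (\<lambda>y. k (stereo s y $ 3) * Re (zeta y ^ m))) y) =
    4 / (1 + y \<bullet> y)\<^sup>2 * (((1 - (p$3)\<^sup>2) * k2 (p$3) - 2 * p$3 * k1 (p$3)
       + 2 * s * real m * k1 (p$3)) * Re (zeta y ^ m))"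
    using laplacian_height_times_harmonic[OF s(1), where k = k and ?k1.0 = k1 and ?k2.0 = k2 and y = y and m = m] unfolding py by blast
  define r where "r = 1 - s * p$3"
  have r: "r \<noteq> 0" "p$3 = s * (1 - r)"
    using one_minus_height[OF s(1), of y] one_plus_inner_pos[of y] s(1)
    by (auto simp: r_def py)
  have Phi: "H (stereo s y $ 3) * Re (Complex (stereo s y $ 1) (stereo s y $ 2) ^ m) =
      k (stereo s y $ 3) * Re (zeta y ^ m)" for y
    unfolding Complex_stereo[OF s(1)] k_def power_mult_distrib of_real_power[symmetric]
    by simp
  have eq: "(1 - (p$3)\<^sup>2) * k2 (p$3) - 2 * p$3 * k1 (p$3) + 2 * s * real m * k1 (p$3) =
    (1 - s * p$3) ^ m * ((1 - (p$3)\<^sup>2) * H2 (p$3) - 2 * (real m + 1) * p$3 * H1 (p$3)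
      - real m * (real m + 1) * H (p$3))"
  proof -
    have "s * (s * (1 - r)) = 1 - r" using ss by (simp flip: mult.assoc)
    moreover define u where "u = inverse r"
    moreover define Q where "Q = r ^ m"
    moreover have "r * u = 1" using r by (simp add: u_def)
    ultimately show ?thesis
      unfolding k1_def k2_def r_def[symmetric] divide_inverse power_inverse[symmetric] u_def[symmetric] Q_def[symmetric]
      using ss r(2) by algebra
  qed
  have "laplace_beltrami round_metric (\<lambda>p. H (p$3) * Re (Complex (p$1) (p$2) ^ m)) p =
     (1 + y \<bullet> y)\<^sup>2 / 4 * (\<Sum>i\<in>UNIV. partial_deriv i (partial_deriv i
       (\<lambda>y. k (stereo s y $ 3) * Re (zeta y ^ m))) y)"
    unfolding laplace_beltrami_def s_def[symmetric] Let_def y_def[symmetric]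
      laplace_beltrami_coord_round[OF s(1)] power2_norm_eq_inner Phi ..
  also have "\<dots> = ((1 - (p$3)\<^sup>2) * H2 (p$3) - 2 * (real m + 1) * p$3 * H1 (p$3)
      - real m * (real m + 1) * H (p$3)) * ((1 - s * p$3) ^ m * Re (zeta y ^ m))"
    unfolding lap eq using one_plus_inner_pos[of y] by simp
  also have "(1 - s * p$3) ^ m * Re (zeta y ^ m) = Re (Complex (p$1) (p$2) ^ m)"
    unfolding Complex_stereo[OF s(1), of y, unfolded py] power_mult_distrib of_real_power[symmetric]
    by simp
  finally show ?thesis .
qed

section \<open>An oscillating flat profile\<close>

text \<open>The variable is \<open>x = \<epsilon>/z\<^sup>2\<close>, so that \<open>x \<rightarrow> \<infinity>\<close> at the equator. There the second summand
  dominates and makes the sign alternate; away from the equator, for small \<open>x\<close>, the function is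
  close to 1. The coefficient 1/16 keeps the
  contribution of the oscillation to the second derivative of the ripple below at most 1.\<close>

definition osc :: "real \<Rightarrow> real" where
  "osc x = exp (- 2 * x) + exp (- x) * sin x / 16"

lemma osc_pos: "osc (pi / 2 + 2 * real n * pi) > 0"
proof -
  have "sin (pi / 2 + 2 * real n * pi) = 1"
    by (simp only: sin_add sin_2npi cos_2npi sin_pi_half mult_1_left mult_1_right mult_zero_right add_0_right)
  then show ?thesis unfolding osc_def by (simp add: add_pos_pos)
qed

lemma osc_neg: "osc (3 / 2 * pi + 2 * real n * pi) < 0"
proof -
  define x where "x = 3 / 2 * pi + 2 * real n * pi"
  have "sin (3 / 2 * pi + 2 * real n * pi) = - 1"
    by (simp only: sin_add sin_2npi cos_2npi sin_3over2_pi mult_1_left mult_1_right mult_zero_right mult_zero_left add_0_right)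
  then have sin: "sin x = - 1" by (simp add: x_def)
  \<comment> \<open>At such points the sign is decided by \<open>exp (-x) < 1/16\<close>, for which \<open>x > 4\<close> suffices.\<close>
  have "(2::real) ^ 4 \<le> exp 1 ^ 4"
    using exp_ge_add_one_self[of 1] by (intro power_mono) auto
  also have "\<dots> = exp 4" by (simp flip: exp_of_nat_mult)
  also have "exp 4 < exp x"
  proof -
    have "0 \<le> 2 * real n * pi" by simp
    then have "4 < x" unfolding x_def using pi_gt3 by linarith
    then show ?thesis by simp
  qed
  finally have "exp (- x) < 1 / 16"
    by (simp add: exp_minus field_simps)
  then have "exp (- x) * exp (- x) < exp (- x) * (1 / 16)"
    by (simp only: mult_less_cancel_left_pos[OF exp_gt_zero])
  then show ?thesis
    unfolding osc_def x_def[symmetric] sin by (simp flip: exp_add)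
qed

text \<open>In terms of \<open>E = osc\<close>, the quantities \<open>P = E - x E'\<close> and \<open>Q = E - x E' + 2 x\<^sup>2 E''\<close> arise from
  the first two derivatives of \<open>z\<^sup>2 E (\<epsilon>/z\<^sup>2)\<close>. The summand \<open>exp (-2x)\<close> contributes values between 0
  and 2 to \<open>Q\<close>, so \<open>|1 - Q|\<close> is at most 1 up to a contribution 1/2 of the oscillation: this margin
  below 2 is what the whole construction rests on.\<close>

lemma osc_bounds:
  fixes x :: real
  assumes "x > 0"
  defines "P \<equiv> exp (- 2 * x) * (1 + 2 * x) + exp (- x) * (sin x - x * cos x + x * sin x) / 16"
    and "Q \<equiv> exp (- 2 * x) * (1 + 2 * x + 8 * x\<^sup>2)
      + exp (- x) * (sin x - x * cos x + x * sin x - 4 * x\<^sup>2 * cos x) / 16"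
  shows "\<bar>1 - osc x\<bar> \<le> 3 * x" "\<bar>1 - P\<bar> \<le> 3 * x" "\<bar>1 - P\<bar> \<le> 2" "\<bar>1 - Q\<bar> \<le> 3 / 2"
proof -
  define u where "u = exp (- x)"
  have u: "0 < u" "u \<le> 1" using assms(1) by (simp_all add: u_def)
  have uu: "exp (- 2 * x) = u * u" by (simp add: u_def flip: exp_add)
  have e: "1 + x + x\<^sup>2 / 2 \<le> exp x"
    using assms(1) by (simp add: exp_lower_Taylor_quadratic)
  have ue: "u * exp x = 1" by (simp add: u_def flip: exp_add)
  have q: "u * (1 + x + x\<^sup>2 / 2) \<le> 1"
    using mult_left_mono[OF e, of u] u ue by simp
  have lower: "1 - 2 * x \<le> u * u"
    unfolding uu[symmetric] using exp_ge_add_one_self[of "- 2 * x"] by simp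
  have sx: "\<bar>sin x\<bar> \<le> x" "\<bar>sin x\<bar> \<le> 1" "\<bar>x * cos x\<bar> \<le> x" "\<bar>x * sin x\<bar> \<le> x"
      "\<bar>x\<^sup>2 * cos x\<bar> \<le> x\<^sup>2"
    using abs_sin_x_le_abs_x[of x] assms(1) by (simp_all add: abs_mult mult_left_le)
  have uabs: "\<bar>u * w\<bar> \<le> r" if "\<bar>w\<bar> \<le> r'" "u * r' \<le> r" for w r r' :: real
  proof -
    have "\<bar>u * w\<bar> \<le> u * r'" using that(1) u by (simp add: abs_mult)
    then show ?thesis using that(2) by linarith
  qed
  have ux: "u * x \<le> x" using u assms(1) by (simp add: mult_le_cancel_right1)
  have qq: "u * u * (1 + 2 * x + 8 * x\<^sup>2) \<le> 2"
  proof -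
    \<comment> \<open>The difference of the two sides of the next inequality.\<close>
    have "0 \<le> 1 + 2 * x * (1 - x)\<^sup>2 + (x\<^sup>2)\<^sup>2 / 2" using assms(1) by simp
    then have "1 + 2 * x + 8 * x\<^sup>2 \<le> 2 * (1 + x + x\<^sup>2 / 2)\<^sup>2"
      by (simp add: power2_eq_square algebra_simps)
    then have "u * u * (1 + 2 * x + 8 * x\<^sup>2) \<le> u * u * (2 * (1 + x + x\<^sup>2 / 2)\<^sup>2)"
      using u by (intro mult_left_mono) auto
    also have "\<dots> = 2 * (u * (1 + x + x\<^sup>2 / 2))\<^sup>2"
      by (simp add: power2_eq_square mult_ac)
    also have "\<dots> \<le> 2"
      using q u assms(1) by (simp add: power_le_one)
    finally show ?thesis .
  qed
  have p: "u * u * (1 + 2 * x) \<le> 1"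
  proof -
    have "u * u * (1 + 2 * x) \<le> u * u * exp (2 * x)"
      using exp_ge_add_one_self[of "2 * x"] u by (intro mult_left_mono) auto
    also have "\<dots> = 1" by (simp add: u_def flip: exp_add)
    finally show ?thesis .
  qed
  have p': "u * u \<le> u * u * (1 + 2 * x)" using assms(1) u by simp
  have q0: "0 \<le> u * u * (1 + 2 * x + 8 * x\<^sup>2)" using assms(1) by simp
  have "\<bar>u * sin x\<bar> \<le> x" by (rule uabs[OF sx(1) ux])
  moreover have "u * u \<le> 1" using u by (simp add: mult_le_one)
  ultimately show "\<bar>1 - osc x\<bar> \<le> 3 * x"
    using lower assms(1) unfolding osc_def uu u_def[symmetric] by linarith
  have "\<bar>u * (sin x - x * cos x + x * sin x)\<bar> \<le> 3 * x"
    by (rule uabs[of _ "3 * x"]) (use sx ux in linarith)+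
  then show "\<bar>1 - P\<bar> \<le> 3 * x"
    using lower p p' assms(1) unfolding P_def uu u_def[symmetric] by linarith
  have "u * (1 + 2 * x) \<le> 2"
  proof -
    have "0 \<le> u * (x\<^sup>2 / 2)" using u by simp
    then show ?thesis using q u unfolding distrib_left by linarith
  qed
  then have "\<bar>u * (sin x - x * cos x + x * sin x)\<bar> \<le> 2"
    by (rule uabs[rotated]) (use sx in linarith)
  moreover have "0 \<le> u * u" by simp
  ultimately show "\<bar>1 - P\<bar> \<le> 2"
    using p p' unfolding P_def uu u_def[symmetric] by linarith
  have "u * (1 + 2 * x + 4 * x\<^sup>2) \<le> 8"
  proof -
    have "0 \<le> u * x" using u assms(1) by simp
    then show ?thesis using q u unfolding distrib_left by linarith
  qed
  then have "\<bar>u * (sin x - x * cos x + x * sin x - 4 * x\<^sup>2 * cos x)\<bar> \<le> 8"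
    by (rule uabs[rotated]) (use sx in linarith)
  then show "\<bar>1 - Q\<bar> \<le> 3 / 2"
    using qq q0 unfolding Q_def uu u_def[symmetric] by linarith
qed

text \<open>For \<open>z \<noteq> 0\<close> this is \<open>z\<^sup>2 osc (\<epsilon>/z\<^sup>2)\<close>. Writing it as a sum of real parts of multiples of
  \<^const>\<open>flat\<close> yields the smooth extension to \<open>z = 0\<close> and the derivatives at once; the coefficient
  1 keeps both summands in the same form.\<close>

definition ripple :: "real \<Rightarrow> real \<Rightarrow> real" where
  "ripple \<epsilon> z = Re (1 * flat (Complex (2 * \<epsilon>) 0) 2 z) + Re (\<i> / 16 * flat (Complex \<epsilon> \<epsilon>) 2 z)"

definition ripple_deriv :: "real \<Rightarrow> real \<Rightarrow> real" where
  "ripple_deriv \<epsilon> z = Re (1 * flat_deriv (Complex (2 * \<epsilon>) 0) 2 z) + Re (\<i> / 16 * flat_deriv (Complex \<epsilon> \<epsilon>) 2 z)"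

definition ripple_deriv2 :: "real \<Rightarrow> real \<Rightarrow> real" where
  "ripple_deriv2 \<epsilon> z =
    Re (1 * (of_int 2 * flat_deriv (Complex (2 * \<epsilon>) 0) (2 - 1) z
      + 2 * Complex (2 * \<epsilon>) 0 * flat_deriv (Complex (2 * \<epsilon>) 0) (2 - 3) z)) +
    Re (\<i> / 16 * (of_int 2 * flat_deriv (Complex \<epsilon> \<epsilon>) (2 - 1) z
      + 2 * Complex \<epsilon> \<epsilon> * flat_deriv (Complex \<epsilon> \<epsilon>) (2 - 3) z))"

lemma ripple_has_real_derivative: "\<epsilon> > 0 \<Longrightarrow> (ripple \<epsilon> has_real_derivative ripple_deriv \<epsilon> z) (at z)"
  unfolding ripple_def[abs_def] ripple_deriv_def
  by (intro DERIV_add flat_has_real_derivative) simp_all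

lemma ripple_deriv_has_real_derivative: "\<epsilon> > 0 \<Longrightarrow> (ripple_deriv \<epsilon> has_real_derivative ripple_deriv2 \<epsilon> z) (at z)"
  unfolding ripple_deriv_def[abs_def] ripple_deriv2_def
  by (intro DERIV_add Re_flat_deriv_has_real_derivative) simp_all

lemma C_infinity_ripple [smooth_intros]:
  assumes "\<epsilon> > 0" "C_infinity u"
  shows "C_infinity (\<lambda>y. ripple \<epsilon> (u y))" "C_infinity (\<lambda>y. ripple_deriv \<epsilon> (u y))" "C_infinity (\<lambda>y. ripple_deriv2 \<epsilon> (u y))"
  unfolding ripple_def ripple_deriv_def ripple_deriv2_def distrib_left plus_complex.sel mult.assoc[symmetric]
  by (intro C_infinity_add C_infinity_flat C_infinity_flat_deriv; use assms in simp)+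

lemma exp_minus_Complex_divide_real: "exp (- (Complex a b) / of_real w) = of_real (exp (- (a / w))) * cis (- (b / w))"
proof -
  have eq: "- (Complex a b) / of_real w = Complex (- (a / w)) (- (b / w))"
    by (simp add: complex_eq_iff)
  show ?thesis unfolding eq exp_Complex by (simp add: complex_eq_iff)
qed

lemma ripple_eqs:
  fixes \<epsilon> z :: real
  assumes "z \<noteq> 0"
  defines "x \<equiv> \<epsilon> / z\<^sup>2"
  shows "ripple \<epsilon> z = z\<^sup>2 * osc x"
    and "ripple_deriv \<epsilon> z = 2 * z * (exp (- 2 * x) * (1 + 2 * x) + exp (- x) * (sin x - x * cos x + x * sin x) / 16)"
    and "ripple_deriv2 \<epsilon> z = 2 * (exp (- 2 * x) * (1 + 2 * x + 8 * x\<^sup>2)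
      + exp (- x) * (sin x - x * cos x + x * sin x - 4 * x\<^sup>2 * cos x) / 16)"
proof -
  have \<epsilon>: "\<epsilon> = x * z\<^sup>2" using assms by simp
  have e: "exp (- (Complex (2 * \<epsilon>) 0) / of_real (z\<^sup>2)) = of_real (exp (- 2 * x))"
    "exp (- (Complex \<epsilon> \<epsilon>) / of_real (z\<^sup>2)) = of_real (exp (- x)) * cis (- x)"
    unfolding exp_minus_Complex_divide_real by (simp_all add: x_def)
  define u v where "u = exp (- 2 * x)" and "v = exp (- x)"
  have pw: "z powi 2 = z\<^sup>2" "z powi (2 - 1) = z" "z powi (2 - 3) = inverse z"
    "z powi (2 - 1 - 1) = 1" "z powi (2 - 1 - 3) = inverse (z\<^sup>2)"
    "z powi (2 - 3 - 1) = inverse (z\<^sup>2)" "z powi (2 - 3 - 3) = inverse (z^4)"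
    by (simp_all add: power_int_def power_inverse)
  show "ripple \<epsilon> z = z\<^sup>2 * osc x"
    using assms(1) unfolding ripple_def flat_def e pw osc_def u_def[symmetric] v_def[symmetric]
    by (simp add: algebra_simps)
  show "ripple_deriv \<epsilon> z = 2 * z * (exp (- 2 * x) * (1 + 2 * x) + exp (- x) * (sin x - x * cos x + x * sin x) / 16)"
    using assms(1) unfolding ripple_deriv_def flat_deriv_def flat_def e pw u_def[symmetric] v_def[symmetric]
    by (simp add: \<epsilon> field_simps power2_eq_square)
  show "ripple_deriv2 \<epsilon> z = 2 * (exp (- 2 * x) * (1 + 2 * x + 8 * x\<^sup>2)
      + exp (- x) * (sin x - x * cos x + x * sin x - 4 * x\<^sup>2 * cos x) / 16)"
    using assms(1) unfolding ripple_deriv2_def flat_deriv_def flat_def e pw u_def[symmetric] v_def[symmetric]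
    by (simp add: \<epsilon> field_simps power2_eq_square power4_eq_xxxx)
qed

text \<open>The difference \<open>z\<^sup>2 - ripple \<epsilon> z\<close> follows the parabola \<open>z\<^sup>2\<close> near the equator and levels off at
  heights beyond \<open>\<surd>\<epsilon>\<close>. It has the scaling of a function of \<open>z/\<surd>\<epsilon>\<close> times \<open>\<epsilon>\<close>, so everything is of
  order \<open>\<epsilon>\<close> except the second derivative, for which the constant matters.\<close>

lemma profile_bounds:
  assumes "\<epsilon> > 0"
  shows "\<bar>z\<^sup>2 - ripple \<epsilon> z\<bar> \<le> 3 * \<epsilon>" "\<bar>z * (2 * z - ripple_deriv \<epsilon> z)\<bar> \<le> 6 * \<epsilon>"
    "(2 * z - ripple_deriv \<epsilon> z)\<^sup>2 \<le> 24 * \<epsilon>" "\<bar>2 - ripple_deriv2 \<epsilon> z\<bar> \<le> 3"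
proof -
  have "\<bar>z\<^sup>2 - ripple \<epsilon> z\<bar> \<le> 3 * \<epsilon> \<and> \<bar>z * (2 * z - ripple_deriv \<epsilon> z)\<bar> \<le> 6 * \<epsilon> \<and>
    (2 * z - ripple_deriv \<epsilon> z)\<^sup>2 \<le> 24 * \<epsilon> \<and> \<bar>2 - ripple_deriv2 \<epsilon> z\<bar> \<le> 3"
  proof (cases "z = 0")
    case True
    then show ?thesis using assms
      by (simp add: ripple_def ripple_deriv_def ripple_deriv2_def flat_deriv_def flat_def)
  next
    case False
    define x where "x = \<epsilon> / z\<^sup>2"
    have x: "x > 0" "z\<^sup>2 * x = \<epsilon>" using False assms by (simp_all add: x_def)
    define P where "P = exp (- 2 * x) * (1 + 2 * x) + exp (- x) * (sin x - x * cos x + x * sin x) / 16"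
    define Q where "Q = exp (- 2 * x) * (1 + 2 * x + 8 * x\<^sup>2)
      + exp (- x) * (sin x - x * cos x + x * sin x - 4 * x\<^sup>2 * cos x) / 16"
    note b = osc_bounds[OF x(1), folded P_def Q_def]
    note eqs = ripple_eqs[OF False, of \<epsilon>, folded x_def, folded P_def Q_def]
    have sc: "z\<^sup>2 * w \<le> 3 * \<epsilon>" if "w \<le> 3 * x" for w
    proof -
      have "z\<^sup>2 * w \<le> z\<^sup>2 * (3 * x)" using that by (rule mult_left_mono) simp
      then show ?thesis using x(2) by linarith
    qed
    have "\<bar>z\<^sup>2 - ripple \<epsilon> z\<bar> = z\<^sup>2 * \<bar>1 - osc x\<bar>"
    proof -
      have "z\<^sup>2 - ripple \<epsilon> z = z\<^sup>2 * (1 - osc x)" by (simp add: eqs algebra_simps)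
      then show ?thesis by (simp add: abs_mult)
    qed
    moreover have "\<bar>z * (2 * z - ripple_deriv \<epsilon> z)\<bar> = 2 * (z\<^sup>2 * \<bar>1 - P\<bar>)"
    proof -
      have "z * (2 * z - ripple_deriv \<epsilon> z) = 2 * (z\<^sup>2 * (1 - P))"
        unfolding eqs by (simp add: power2_eq_square algebra_simps)
      then show ?thesis by (simp add: abs_mult)
    qed
    moreover have "(2 * z - ripple_deriv \<epsilon> z)\<^sup>2 = 4 * (z\<^sup>2 * (\<bar>1 - P\<bar> * \<bar>1 - P\<bar>))"
      unfolding eqs by (simp add: power2_eq_square algebra_simps)
    moreover have "\<bar>1 - P\<bar> * \<bar>1 - P\<bar> \<le> 2 * (3 * x)"
      using b(2,3) x(1) by (intro mult_mono) auto
    moreover have "\<bar>2 - ripple_deriv2 \<epsilon> z\<bar> = 2 * \<bar>1 - Q\<bar>"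
      unfolding eqs by (simp add: abs_if)
    ultimately show ?thesis
      using sc[OF b(1)] sc[OF b(2)] sc[of "\<bar>1 - P\<bar> * \<bar>1 - P\<bar> / 2"] b(4)
      by (intro conjI) linarith+
  qed
  then show "\<bar>z\<^sup>2 - ripple \<epsilon> z\<bar> \<le> 3 * \<epsilon>" "\<bar>z * (2 * z - ripple_deriv \<epsilon> z)\<bar> \<le> 6 * \<epsilon>"
    "(2 * z - ripple_deriv \<epsilon> z)\<^sup>2 \<le> 24 * \<epsilon>" "\<bar>2 - ripple_deriv2 \<epsilon> z\<bar> \<le> 3" by blast+
qed

text \<open>With \<open>profile\<close> replaced by \<open>1 - z\<^sup>2\<close>, the function \<open>rippled_harmonic\<close> below would have the
  constant value 1 along the meridian \<open>y = 0, x > 0\<close>; the ripple decides where it lies above or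
  below 1.\<close>

definition profile :: "real \<Rightarrow> real \<Rightarrow> real" where
  "profile \<epsilon> z = 1 - z\<^sup>2 + ripple \<epsilon> z"

definition profile_deriv :: "real \<Rightarrow> real \<Rightarrow> real" where
  "profile_deriv \<epsilon> z = - 2 * z + ripple_deriv \<epsilon> z"

definition profile_deriv2 :: "real \<Rightarrow> real \<Rightarrow> real" where
  "profile_deriv2 \<epsilon> z = - 2 + ripple_deriv2 \<epsilon> z"

lemma profile_ge:
  assumes "0 < \<epsilon>" "\<epsilon> \<le> 1 / 100"
  shows "97 / 100 \<le> profile \<epsilon> z"
  using profile_bounds(1)[OF assms(1), of z] assms(2) by (auto simp: profile_def)

lemma profile_pos: "0 < \<epsilon> \<Longrightarrow> \<epsilon> \<le> 1 / 100 \<Longrightarrow> 0 < profile \<epsilon> z"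
  using profile_ge[of \<epsilon> z] by simp

lemma profile_has_real_derivative:
  assumes "\<epsilon> > 0"
  shows "(profile \<epsilon> has_real_derivative profile_deriv \<epsilon> z) (at z)"
    and "(profile_deriv \<epsilon> has_real_derivative profile_deriv2 \<epsilon> z) (at z)"
  unfolding profile_def[abs_def] profile_deriv_def[abs_def] profile_deriv2_def
  by (auto intro!: derivative_eq_intros ripple_has_real_derivative ripple_deriv_has_real_derivative assms)

lemma C_infinity_profile:
  assumes "\<epsilon> > 0" "C_infinity u"
  shows "C_infinity (\<lambda>y. profile \<epsilon> (u y))" "C_infinity (\<lambda>y. profile_deriv \<epsilon> (u y))"
    "C_infinity (\<lambda>y. profile_deriv2 \<epsilon> (u y))"
  unfolding profile_def profile_deriv_def profile_deriv2_def
  by (intro smooth_intros assms)+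

section \<open>The rippled harmonic and its conformal factor\<close>

text \<open>This is \<open>((1 - z\<^sup>2) H'' - 2 (m + 1) z H') / H\<close> for \<open>H = profile powr (-m/2)\<close>, the amount by which
  the factor \<open>H\<close> lowers \<open>m (m + 1)\<close>. The powers of the profile cancel in the quotient, which
  leaves a rational expression in the profile and its derivatives.\<close>

definition defect :: "nat \<Rightarrow> real \<Rightarrow> real \<Rightarrow> real" where
  "defect m \<epsilon> z = (1 - z\<^sup>2) * (- (real m / 2) * (profile_deriv2 \<epsilon> z / profile \<epsilon> z)
      + (real m / 2) * (real m / 2 + 1) * (profile_deriv \<epsilon> z / profile \<epsilon> z)\<^sup>2)
    + (real m + 1) * real m * (z * profile_deriv \<epsilon> z / profile \<epsilon> z)"

definition conformal_factor :: "nat \<Rightarrow> real \<Rightarrow> real^3 \<Rightarrow> real" where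
  "conformal_factor m \<epsilon> p = 1 - defect m \<epsilon> (p$3) / (real m * (real m + 1))"

definition rippled_harmonic :: "nat \<Rightarrow> real \<Rightarrow> real^3 \<Rightarrow> real" where
  "rippled_harmonic m \<epsilon> p = profile \<epsilon> (p$3) powr (- (m / 2)) * Re (Complex (p$1) (p$2) ^ m)"

lemma laplace_beltrami_rippled_harmonic:
  assumes e: "0 < \<epsilon>" "\<epsilon> \<le> 1 / 100" and "m > 0" and p: "p \<in> S2"
  shows "laplace_beltrami round_metric (rippled_harmonic m \<epsilon>) p =
    - (real m * (real m + 1)) * conformal_factor m \<epsilon> p * rippled_harmonic m \<epsilon> p"
proof -
  define \<mu> where "\<mu> = real m / 2"
  note pos = profile_pos[OF e]
  define H where "H z = profile \<epsilon> z powr (- \<mu>)" for z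
  define H1 where "H1 z = - \<mu> * profile_deriv \<epsilon> z * profile \<epsilon> z powr (- \<mu> - 1)" for z
  define H2 where "H2 z = - \<mu> * profile_deriv2 \<epsilon> z * profile \<epsilon> z powr (- \<mu> - 1)
    + \<mu> * (\<mu> + 1) * (profile_deriv \<epsilon> z)\<^sup>2 * profile \<epsilon> z powr (- \<mu> - 2)" for z
  have pw: "((\<lambda>z. profile \<epsilon> z powr a) has_real_derivative
      a * profile \<epsilon> z powr (a - 1) * profile_deriv \<epsilon> z) (at z)" for a z
    using DERIV_chain2[OF has_real_derivative_powr[OF pos] profile_has_real_derivative(1)[OF e(1)]] .
  have H1: "(H has_real_derivative H1 z) (at z)" for z
    unfolding H_def H1_def by (rule DERIV_cong[OF pw]) simp
  have H2: "(H1 has_real_derivative H2 z) (at z)" for z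
    unfolding H1_def H2_def
    by (rule derivative_eq_intros pw profile_has_real_derivative[OF e(1)] refl)+
      (simp add: algebra_simps power2_eq_square)
  define z where "z = p$3"
  have pw': "profile \<epsilon> z powr (- \<mu> - 1) = H z / profile \<epsilon> z"
    "profile \<epsilon> z powr (- \<mu> - 2) = H z / (profile \<epsilon> z)\<^sup>2"
    using pos[of z] by (simp_all add: H_def powr_diff)
  have Phi: "rippled_harmonic m \<epsilon> = (\<lambda>p. H (p$3) * Re (Complex (p$1) (p$2) ^ m))"
    by (simp add: fun_eq_iff rippled_harmonic_def H_def \<mu>_def)
  have "(1 - z\<^sup>2) * H2 z - 2 * (real m + 1) * z * H1 z = defect m \<epsilon> z * H z"
  proof -
    have m: "real m = 2 * \<mu>" by (simp add: \<mu>_def)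
    define b where "b = inverse (profile \<epsilon> z)"
    show ?thesis
      unfolding H1_def H2_def pw' defect_def m divide_inverse power_inverse[symmetric] b_def[symmetric]
      by (simp add: algebra_simps power2_eq_square)
  qed
  moreover have "defect m \<epsilon> z - real m * (real m + 1) = - (real m * (real m + 1)) * conformal_factor m \<epsilon> p"
  proof -
    define M where "M = real m * (real m + 1)"
    have "M \<noteq> 0" using assms(3) by (simp add: M_def)
    then show ?thesis
      unfolding conformal_factor_def z_def M_def[symmetric] by (simp add: right_diff_distrib)
  qed
  ultimately have "(1 - z\<^sup>2) * H2 z - 2 * (real m + 1) * z * H1 z - real m * (real m + 1) * H z =
      - (real m * (real m + 1)) * conformal_factor m \<epsilon> p * H z"
    by (metis left_diff_distrib)
  then show ?thesis
    unfolding Phi laplace_beltrami_height_times_sectoral[OF H1 H2 p] z_def[symmetric]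
    by (simp add: mult.assoc)
qed

text \<open>The allowance \<open>2 (m + 1)\<close> is linear in \<open>m\<close>. The term \<open>-(m/2) profile''/profile\<close> uses about three
  quarters of it. The terms quadratic in \<open>m\<close> carry a factor \<open>\<epsilon>\<close> by the scaling of the profile, and the choice
  \<open>\<epsilon> = 1/(100 m)\<close> makes them linear in \<open>m\<close> with a small coefficient.\<close>

lemma abs_defect_le:
  assumes m: "m > 0" and \<epsilon>: "\<epsilon> = 1 / (100 * real m)" and z: "\<bar>z\<bar> \<le> 1"
  shows "\<bar>defect m \<epsilon> z\<bar> \<le> 2 * (real m + 1)"
proof -
  have e: "0 < \<epsilon>" "\<epsilon> \<le> 1 / 100" and em: "real m * \<epsilon> = 1 / 100"
    using m by (simp_all add: \<epsilon> field_simps)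
  define v where "v = 1 / profile \<epsilon> z"
  have v: "0 \<le> v" "v \<le> 104 / 100"
    using profile_ge[OF e, of z] by (simp_all add: v_def field_simps)
  have vv: "v\<^sup>2 \<le> 11 / 10"
    using mult_mono[OF v(2,2)] v(1) by (simp add: power2_eq_square)
  have z2: "0 \<le> 1 - z\<^sup>2" "1 - z\<^sup>2 \<le> 1" using z by (simp_all add: abs_square_le_1)
  note b = profile_bounds[OF e(1), of z]
  have "0": "\<bar>profile_deriv2 \<epsilon> z * v\<bar> \<le> 3 * (104 / 100)"
    unfolding abs_mult using b(4) v by (intro mult_mono) (auto simp: profile_deriv2_def)
  have 1: "\<bar>(real m / 2) * (profile_deriv2 \<epsilon> z * v)\<bar> \<le> (real m / 2) * (312 / 100)"
    using mult_left_mono[OF "0", of "real m / 2"] unfolding abs_mult[of "real m / 2"] by simp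
  have "(profile_deriv \<epsilon> z)\<^sup>2 \<le> 24 * \<epsilon>"
    using b(3) by (simp add: profile_deriv_def power2_eq_square algebra_simps)
  then have "(profile_deriv \<epsilon> z * v)\<^sup>2 \<le> 24 * \<epsilon> * (11 / 10)"
    unfolding power_mult_distrib using vv e by (intro mult_mono) auto
  then have "(real m / 2) * (real m / 2 + 1) * (profile_deriv \<epsilon> z * v)\<^sup>2 \<le> (real m / 2) * (real m / 2 + 1) * (24 * \<epsilon> * (11 / 10))"
    by (intro mult_left_mono) auto
  also have "\<dots> = (real m / 2 + 1) * (real m * \<epsilon>) * (132 / 10)" by simp
  finally have 2: "(real m / 2) * (real m / 2 + 1) * (profile_deriv \<epsilon> z * v)\<^sup>2 \<le> (real m / 2 + 1) * (132 / 1000)"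
    unfolding em by simp
  have 3: "0 \<le> (real m / 2) * (real m / 2 + 1) * (profile_deriv \<epsilon> z * v)\<^sup>2" by simp
  have "z * profile_deriv \<epsilon> z = - (z * (2 * z - ripple_deriv \<epsilon> z))"
    by (simp add: profile_deriv_def algebra_simps)
  then have "\<bar>z * profile_deriv \<epsilon> z\<bar> \<le> 6 * \<epsilon>" using b(2) by simp
  then have "\<bar>z * profile_deriv \<epsilon> z * v\<bar> \<le> 6 * \<epsilon> * (104 / 100)"
    unfolding abs_mult[of _ v]
    using v e by (intro mult_mono) auto
  then have "(real m + 1) * real m * \<bar>z * profile_deriv \<epsilon> z * v\<bar> \<le> (real m + 1) * real m * (6 * \<epsilon> * (104 / 100))"
    by (intro mult_left_mono) auto
  also have "\<dots> = (real m + 1) * (real m * \<epsilon>) * (624 / 100)" by (simp add: algebra_simps)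
  finally have 4: "\<bar>(real m + 1) * real m * (z * profile_deriv \<epsilon> z * v)\<bar> \<le> (real m + 1) * (624 / 10000)"
    unfolding em by (simp add: abs_mult)
  define Y where "Y = (real m + 1) * real m * (z * profile_deriv \<epsilon> z * v)"
  define X where "X = - (real m / 2) * (profile_deriv2 \<epsilon> z * v) + (real m / 2) * (real m / 2 + 1) * (profile_deriv \<epsilon> z * v)\<^sup>2"
  have "\<bar>X\<bar> \<le> (real m / 2) * (312 / 100) + (real m / 2 + 1) * (132 / 1000)"
    using 1 2 3 unfolding X_def by linarith
  moreover have "\<bar>(1 - z\<^sup>2) * X\<bar> \<le> \<bar>X\<bar>"
    using z2 by (simp add: abs_mult mult_left_le_one_le)
  moreover have "\<bar>defect m \<epsilon> z\<bar> \<le> \<bar>(1 - z\<^sup>2) * X\<bar> + \<bar>Y\<bar>"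
  proof -
    have "defect m \<epsilon> z = (1 - z\<^sup>2) * X + Y"
      by (simp add: defect_def X_def Y_def v_def)
    then show ?thesis by (metis abs_triangle_ineq)
  qed
  moreover have "real m \<ge> 1" using m by simp
  ultimately show ?thesis
    using 4 unfolding Y_def[symmetric] by (simp only: distrib_left distrib_right)
qed

lemma smooth_rippled_harmonic:
  assumes e: "0 < \<epsilon>" "\<epsilon> \<le> 1 / 100"
  shows "smooth_on_S2 (rippled_harmonic m \<epsilon>)"
  unfolding smooth_on_S2_def
proof
  fix s :: real assume s: "s \<in> {1, -1}"
  have "rippled_harmonic m \<epsilon> (stereo s y) = profile \<epsilon> (stereo s y $ 3) powr (- (m / 2))
      * ((1 - s * stereo s y $ 3) ^ m * Re (1 * zeta y ^ m))" for y
    unfolding rippled_harmonic_def Complex_stereo[OF s] power_mult_distrib of_real_power[symmetric] by simp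
  then show "C_infinity (\<lambda>y. rippled_harmonic m \<epsilon> (stereo s y))"
    by (simp only:) (intro smooth_intros C_infinity_powr C_infinity_profile C_infinity_stereo_height
        profile_pos e)
qed

lemma smooth_conformal_factor:
  assumes e: "0 < \<epsilon>" "\<epsilon> \<le> 1 / 100"
  shows "smooth_on_S2 (conformal_factor m \<epsilon>)"
  unfolding smooth_on_S2_def conformal_factor_def defect_def divide_inverse[of _ "real m * _"]
  by (intro ballI smooth_intros C_infinity_divide C_infinity_profile C_infinity_stereo_height
      profile_pos e)

section \<open>Components of the super-level set\<close>

text \<open>The image of a component under a continuous real function is an interval. If it contained the
  values at two of the points, it would contain a separating value \<open>t n\<close>.\<close>

lemma infinite_components_if_separated:
  fixes f :: "'a::topological_space \<Rightarrow> real"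
  assumes cont: "continuous_on S f"
    and mem: "\<And>n::nat. a n \<in> S"
    and sep: "\<And>n. f (a (Suc n)) < t n" "\<And>n. t n < f (a n)"
    and gap: "\<And>n x. x \<in> S \<Longrightarrow> f x \<noteq> t n"
  shows "infinite (components S)"
proof
  define C where "C n = connected_component_set S (a n)" for n
  have dec: "decseq (\<lambda>n. f (a n))"
    using sep by (intro decseq_SucI) (meson less_imp_le less_trans)
  have ne: "C n \<noteq> C k" if "n < k" for n k
  proof
    assume eq: "C n = C k"
    have "a j \<in> C j" for j using mem by (simp add: C_def)
    then have "a n \<in> C n" "a k \<in> C n" using eq by auto
    then have img: "f (a n) \<in> f ` C n" "f (a k) \<in> f ` C n" by simp_all
    have "f (a k) \<le> t n"
      using decseqD[OF dec, of "Suc n" k] that sep(1)[of n] by simp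
    moreover have "connected (f ` C n)"
      by (rule connected_continuous_image[OF continuous_on_subset[OF cont]])
        (auto simp: C_def connected_component_subset)
    ultimately have "t n \<in> f ` C n"
      using connectedD_interval[OF _ img(2) img(1)] sep(2)[of n] by simp
    then obtain x where "x \<in> C n" "f x = t n" by auto
    then show False
      using gap[of x n] connected_component_subset[of S "a n"] by (auto simp: C_def)
  qed
  have "inj C"
    by (rule injI) (metis ne linorder_neqE_nat)
  moreover have "range C \<subseteq> components S"
    using mem by (auto simp: C_def components_def)
  moreover assume "finite (components S)"
  ultimately show False
    using finite_subset range_inj_infinite by blast
qed

lemma profile_powr_half:
  assumes "0 < \<epsilon>" "\<epsilon> \<le> 1 / 100"
  shows "profile \<epsilon> z powr (- (m / 2)) * sqrt (profile \<epsilon> z) ^ m = 1"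
proof -
  have pos: "profile \<epsilon> z > 0" by (rule profile_pos[OF assms])
  have "sqrt (profile \<epsilon> z) ^ m = profile \<epsilon> z powr (m / 2)"
    using pos by (simp add: powr_half_sqrt[symmetric] powr_realpow[symmetric] powr_powr)
  then show ?thesis using pos by (simp flip: powr_add)
qed

text \<open>At height \<open>z\<close> the modulus of \<open>x + iy\<close> is \<open>\<surd>(1 - z\<^sup>2)\<close>, so exceeding 1 forces
  \<open>1 - z\<^sup>2 > profile \<epsilon> z\<close>. Conversely that inequality suffices at longitude 0, where \<open>Re ((x + iy)\<^sup>m)\<close>
  attains this modulus to the power \<open>m\<close>.\<close>

lemma ripple_neg_if_rippled_harmonic_gt_1:
  assumes e: "0 < \<epsilon>" "\<epsilon> \<le> 1 / 100" and p: "p \<in> S2" "rippled_harmonic m \<epsilon> p > 1"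
  shows "ripple \<epsilon> (p$3) < 0"
proof (rule ccontr)
  assume "\<not> ripple \<epsilon> (p$3) < 0"
  moreover have "(cmod (Complex (p$1) (p$2)))\<^sup>2 = 1 - (p$3)\<^sup>2"
    using p(1) unfolding S2_iff by (simp add: cmod_power2)
  ultimately have "cmod (Complex (p$1) (p$2)) \<le> sqrt (profile \<epsilon> (p$3))"
    by (intro real_le_rsqrt) (simp add: profile_def)
  then have "cmod (Complex (p$1) (p$2)) ^ m \<le> sqrt (profile \<epsilon> (p$3)) ^ m"
    by (rule power_mono) simp
  then have "Re (Complex (p$1) (p$2) ^ m) \<le> sqrt (profile \<epsilon> (p$3)) ^ m"
    using complex_Re_le_cmod[of "Complex (p$1) (p$2) ^ m"] by (simp add: norm_power)
  then have "rippled_harmonic m \<epsilon> p \<le> profile \<epsilon> (p$3) powr (- (m / 2)) * sqrt (profile \<epsilon> (p$3)) ^ m"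
    unfolding rippled_harmonic_def by (rule mult_left_mono) simp
  then show False using p(2) profile_powr_half[OF e] by simp
qed

lemma rippled_harmonic_gt_1_if_ripple_neg:
  assumes e: "0 < \<epsilon>" "\<epsilon> \<le> 1 / 100" and m: "m > 0" and z: "ripple \<epsilon> z < 0"
  shows "rippled_harmonic m \<epsilon> (vector [sqrt (1 - z\<^sup>2), 0, z]) > 1"
proof -
  define r where "r = sqrt (1 - z\<^sup>2)"
  have "sqrt (profile \<epsilon> z) < r"
    using z by (simp add: r_def profile_def)
  then have "sqrt (profile \<epsilon> z) ^ m < r ^ m"
    using m profile_pos[OF e, of z] by (intro power_strict_mono) auto
  then have "profile \<epsilon> z powr (- (m / 2)) * sqrt (profile \<epsilon> z) ^ m < profile \<epsilon> z powr (- (m / 2)) * r ^ m"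
    using profile_pos[OF e, of z] by (intro mult_strict_left_mono) auto
  moreover have "Complex r 0 ^ m = of_real (r ^ m)"
    by (simp add: complex_of_real_def[symmetric])
  ultimately show ?thesis
    unfolding rippled_harmonic_def profile_powr_half[OF e] r_def[symmetric] by simp
qed

text \<open>The heights \<open>\<surd>(\<epsilon>/x)\<close> with \<open>sin x = -1\<close> belong to points of the super-level set, and those with
  \<open>sin x = 1\<close> to parallels that it avoids; both sequences decrease to the equator and interlace.\<close>

lemma infinite_components_rippled_harmonic:
  assumes e: "0 < \<epsilon>" "\<epsilon> \<le> 1 / 100" and m: "m > 0"
  shows "infinite (components {p \<in> S2. rippled_harmonic m \<epsilon> p > 1})"
proof -
  define h where "h x = sqrt (\<epsilon> / x)" for x
  have ripple_h: "ripple \<epsilon> (h x) = \<epsilon> / x * osc x" if "x > 0" for x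
    using ripple_eqs(1)[of "h x" \<epsilon>] that e by (simp add: h_def)
  have h_less: "h x' < h x" if "0 < x" "x < x'" for x x'
    using that e by (simp add: h_def frac_less2)
  define a where "a n = 3 / 2 * pi + 2 * real n * pi" for n
  \<comment> \<open>\<open>Suc n\<close> places \<open>b n\<close> between \<open>a n\<close> and \<open>a (Suc n)\<close>.\<close>
  define b where "b n = pi / 2 + 2 * real (Suc n) * pi" for n
  have ab: "0 < a n" "3 < a n" "a n < b n" "b n < a (Suc n)" "0 < b n" for n
  proof -
    have "0 \<le> real n * pi" by simp
    moreover have "2 * real (Suc n) * pi = 2 * (real n * pi) + 2 * pi" by (simp add: algebra_simps)
    ultimately show "0 < a n" "3 < a n" "a n < b n" "b n < a (Suc n)" "0 < b n"
      unfolding a_def b_def using pi_gt3 by linarith+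
  qed
  define P where "P n = (vector [sqrt (1 - (h (a n))\<^sup>2), 0, h (a n)] :: real^3)" for n
  show ?thesis
  proof (rule infinite_components_if_separated[where f = "\<lambda>p. p$3" and a = P and t = "\<lambda>n. h (b n)"])
    show "continuous_on {p \<in> S2. rippled_harmonic m \<epsilon> p > 1} (\<lambda>p. p$3)"
      by (intro continuous_intros)
    show "P n \<in> {p \<in> S2. rippled_harmonic m \<epsilon> p > 1}" for n
    proof -
      have "(h (a n))\<^sup>2 \<le> 1"
        using e ab(1,2)[of n] by (simp add: h_def)
      then have "P n \<in> S2" unfolding S2_iff P_def by simp
      moreover have "ripple \<epsilon> (h (a n)) < 0"
        unfolding ripple_h[OF ab(1)] using osc_neg[of n] e ab(1)[of n] unfolding a_def[symmetric]
        by (intro mult_pos_neg) auto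
      ultimately show ?thesis
        using rippled_harmonic_gt_1_if_ripple_neg[OF e m] by (simp add: P_def)
    qed
    show "P (Suc n) $ 3 < h (b n)" for n
      unfolding P_def vector_3 using h_less[OF ab(5,4)] .
    show "h (b n) < P n $ 3" for n
      unfolding P_def vector_3 using h_less[OF ab(1,3)] .
    show "p $ 3 \<noteq> h (b n)" if "p \<in> {p \<in> S2. rippled_harmonic m \<epsilon> p > 1}" for n p
    proof
      assume "p $ 3 = h (b n)"
      then have "ripple \<epsilon> (h (b n)) < 0"
        using ripple_neg_if_rippled_harmonic_gt_1[OF e, of p m] that by simp
      moreover have "osc (b n) > 0" unfolding b_def by (rule osc_pos)
      ultimately show False
        using e ab(5)[of n] by (simp add: ripple_h mult_less_0_iff divide_less_0_iff)
    qed
  qed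
qed

section \<open>The perturbed eigenvalue equation\<close>

theorem proposition5p2:
  shows "\<exists>M::real. M > 0 \<and> (\<forall>m::int. real_of_int m \<ge> M \<longrightarrow>
    (\<exists>\<Phi> G :: real^3 \<Rightarrow> real.
       smooth_on_S2 \<Phi> \<and> smooth_on_S2 G \<and>
       infinite (components {p \<in> S2. \<Phi> p > 1}) \<and>
       (\<forall>p\<in>S2. G p > 0) \<and>
       riemannian_metric (conformal_metric G round_metric) \<and>
       (\<forall>f. smooth_on_S2 f \<longrightarrow> (\<forall>p\<in>S2.
          laplace_beltrami (conformal_metric G round_metric) f p =
          inverse (G p) * laplace_beltrami round_metric f p)) \<and>
       (\<forall>p\<in>S2. 1 - 2 / real_of_int m \<le> G p \<and> G p \<le> 1 + 2 / real_of_int m) \<and>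
       (\<forall>p\<in>S2. - laplace_beltrami (conformal_metric G round_metric) \<Phi> p =
          real_of_int m * (real_of_int m + 1) * \<Phi> p)))"
proof (intro exI[of _ 3] conjI allI impI)
  \<comment> \<open>The bound 3 makes \<open>1 - 2/m\<close>, and with it the conformal factor, positive.\<close>
  show "0 < (3::real)" by simp
  fix m :: int assume m3: "3 \<le> real_of_int m"
  define n where "n = nat m"
  define \<epsilon> where "\<epsilon> = 1 / (100 * real n)"
  define G where "G = conformal_factor n \<epsilon>"
  have mn: "real_of_int m = real n" and n: "n \<ge> 3" using m3 by (auto simp: n_def)
  have e: "0 < \<epsilon>" "\<epsilon> \<le> 1 / 100" using n by (simp_all add: \<epsilon>_def field_simps)
  have bounds: "\<bar>G p - 1\<bar> \<le> 2 / real n" if "p \<in> S2" for p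
  proof -
    have "\<bar>p$3\<bar> \<le> 1"
      using component_le_norm_cart[of p 3] that by simp
    then have "\<bar>defect n \<epsilon> (p$3)\<bar> \<le> 2 * (real n + 1)"
      using n by (intro abs_defect_le) (auto simp: \<epsilon>_def)
    then have "\<bar>defect n \<epsilon> (p$3)\<bar> / (real n * (real n + 1)) \<le> 2 * (real n + 1) / (real n * (real n + 1))"
      by (rule divide_right_mono) simp
    also have "\<dots> = 2 / real n" by (rule nonzero_mult_divide_mult_cancel_right) linarith
    finally show ?thesis by (simp add: G_def conformal_factor_def abs_mult)
  qed
  have "2 / real n < 1" using n by simp
  then have pos: "G p > 0" if "p \<in> S2" for p using bounds[OF that] by linarith
  have smooth: "smooth_on_S2 G" unfolding G_def by (rule smooth_conformal_factor[OF e])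
  have eigen: "- laplace_beltrami (conformal_metric G round_metric) (rippled_harmonic n \<epsilon>) p =
      real_of_int m * (real_of_int m + 1) * rippled_harmonic n \<epsilon> p" if "p \<in> S2" for p
  proof -
    have "laplace_beltrami (conformal_metric G round_metric) (rippled_harmonic n \<epsilon>) p =
        inverse (G p) * laplace_beltrami round_metric (rippled_harmonic n \<epsilon>) p"
      by (rule laplace_beltrami_conformal[OF pos that])
    also have "laplace_beltrami round_metric (rippled_harmonic n \<epsilon>) p = - (real n * (real n + 1)) * G p * rippled_harmonic n \<epsilon> p"
      unfolding G_def using n by (intro laplace_beltrami_rippled_harmonic[OF e _ that]) simp
    finally show ?thesis using pos[OF that] by (simp add: mn)
  qed
  show "\<exists>\<Phi> G :: real^3 \<Rightarrow> real.
       smooth_on_S2 \<Phi> \<and> smooth_on_S2 G \<and>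
       infinite (components {p \<in> S2. \<Phi> p > 1}) \<and>
       (\<forall>p\<in>S2. G p > 0) \<and>
       riemannian_metric (conformal_metric G round_metric) \<and>
       (\<forall>f. smooth_on_S2 f \<longrightarrow> (\<forall>p\<in>S2.
          laplace_beltrami (conformal_metric G round_metric) f p =
          inverse (G p) * laplace_beltrami round_metric f p)) \<and>
       (\<forall>p\<in>S2. 1 - 2 / real_of_int m \<le> G p \<and> G p \<le> 1 + 2 / real_of_int m) \<and>
       (\<forall>p\<in>S2. - laplace_beltrami (conformal_metric G round_metric) \<Phi> p =
          real_of_int m * (real_of_int m + 1) * \<Phi> p)"
  proof (intro exI conjI ballI allI impI)
    show "smooth_on_S2 (rippled_harmonic n \<epsilon>)" by (rule smooth_rippled_harmonic[OF e])
    show "smooth_on_S2 G" by (rule smooth)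
    show "infinite (components {p \<in> S2. rippled_harmonic n \<epsilon> p > 1})"
      using n by (intro infinite_components_rippled_harmonic[OF e]) simp
    show "riemannian_metric (conformal_metric G round_metric)"
      by (rule riemannian_metric_conformal[OF pos smooth])
  next
    fix p assume p: "p \<in> S2"
    show "G p > 0" by (rule pos[OF p])
    show "1 - 2 / real_of_int m \<le> G p" "G p \<le> 1 + 2 / real_of_int m"
      using bounds[OF p] unfolding mn by linarith+
    show "- laplace_beltrami (conformal_metric G round_metric) (rippled_harmonic n \<epsilon>) p =
      real_of_int m * (real_of_int m + 1) * rippled_harmonic n \<epsilon> p"
      by (rule eigen[OF p])
    show "laplace_beltrami (conformal_metric G round_metric) f p =
      inverse (G p) * laplace_beltrami round_metric f p" for f
      by (rule laplace_beltrami_conformal[OF pos p])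
  qed
qed

end
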